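(* Let $n>1$, let $F_n$ be the free group on $n$ generators, and let $H=C^*_r(F_n)$ be its reduced group C*-algebra, regarded as a compact quantum group with the coproduct $\Delta_n$ determined by $\Delta_n(g)=g\otimes g$ for $g\in F_n$. Consider the free action of $(H,\Delta_n)$ on $A=H$ given by $\delta=\Delta_n$. Then there does not exist an $(H,\Delta_n)$-equivariant $*$-homomorphism $$C^*_r(F_n)\longrightarrow C^*_r(F_n)\circledast^{\Delta_n}C^*_r(F_n).$$
   Context: All $*$-homomorphisms between unital C*-algebras are unital. For a compact quantum group $(H,\Delta)$ acting on a unital C*-algebra $A$ by a coaction $\delta\colon A\to A\otimes_{\min}H$, the equivariant noncommutative join is $A\circledast^\delta H:=\{f\in C([0,1],A\otimes_{\min}H)\mid f(0)\in\mathbb{C}\otimes H,\ f(1)\in\delta(A)\}$, with the action of $(H,\Delta)$ induced by $f\mapsto(\mathrm{id}\otimes\Delta)\circ f$. Here $A=H=C_r^*(F_n)$ and $\delta=\Delta=\Delta_n$. A $*$-homomorphism $f\colon(A,\delta_A)\to(B,\delta_B)$ between unital C*-algebras with coactions of $(H,\Delta)$ is equivariant iff $\delta_B\circ f=(f\otimes\mathrm{id})\circ\delta_A$. *)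

theory Defs
  imports "HOL-Analysis.Analysis" "HOL-Library.Function_Algebras"
begin

section \<open>The Hilbert space of square-summable functions\<close>

typedef 'a ell2 = "{f :: 'a \<Rightarrow> complex. (\<lambda>x. (cmod (f x))\<^sup>2) summable_on UNIV}"
  morphisms ell2_coord Abs_ell2
  by (rule exI[of _ "\<lambda>_. 0"]) simp

setup_lifting type_definition_ell2

lemma ell2_summable: "(\<lambda>x. (cmod (ell2_coord f x))\<^sup>2) summable_on A"
  using ell2_coord[of f] by (auto intro: summable_on_subset)

lemma ell2_eqI: "(\<And>x. ell2_coord f x = ell2_coord g x) \<Longrightarrow> f = g"
  by (metis ell2_coord_inject ext)

lemma square_summable_bound:
  assumes "\<And>F. finite F \<Longrightarrow> (\<Sum>x\<in>F. (cmod (f x))\<^sup>2) \<le> C"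
  shows "(\<lambda>x. (cmod (f x))\<^sup>2) summable_on UNIV"
  by (rule nonneg_bdd_above_summable_on) (use assms in \<open>auto intro!: bdd_aboveI[of _ C]\<close>)

lemma square_summable_plus:
  fixes f g :: "'a \<Rightarrow> complex"
  assumes "(\<lambda>x. (cmod (f x))\<^sup>2) summable_on UNIV" "(\<lambda>x. (cmod (g x))\<^sup>2) summable_on UNIV"
  shows "(\<lambda>x. (cmod (f x + g x))\<^sup>2) summable_on UNIV"
proof (rule summable_on_comparison_test)
  show "(\<lambda>x. 2 * (cmod (f x))\<^sup>2 + 2 * (cmod (g x))\<^sup>2) summable_on UNIV"
    by (intro summable_on_add summable_on_cmult_right assms)
  fix x
  have "(cmod (f x + g x))\<^sup>2 \<le> (cmod (f x) + cmod (g x))\<^sup>2"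
    by (intro power_mono norm_triangle_ineq) auto
  also have "\<dots> \<le> 2 * (cmod (f x))\<^sup>2 + 2 * (cmod (g x))\<^sup>2"
    using sum_squares_bound[of "cmod (f x)" "cmod (g x)"] by (simp add: power2_sum)
  finally show "(cmod (f x + g x))\<^sup>2 \<le> 2 * (cmod (f x))\<^sup>2 + 2 * (cmod (g x))\<^sup>2" .
qed auto

lemma square_summable_cmult:
  fixes f :: "'a \<Rightarrow> complex"
  assumes "(\<lambda>x. (cmod (f x))\<^sup>2) summable_on UNIV"
  shows "(\<lambda>x. (cmod (c * f x))\<^sup>2) summable_on UNIV"
  unfolding norm_mult power_mult_distrib by (intro summable_on_cmult_right assms)

class scaleC =
  fixes scaleC :: "complex \<Rightarrow> 'a \<Rightarrow> 'a" (infixr \<open>*\<^sub>C\<close> 75)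

instantiation ell2 :: (type) "{real_vector, scaleC}"
begin

lift_definition zero_ell2 :: "'a ell2" is "\<lambda>_. 0" by simp
lift_definition plus_ell2 :: "'a ell2 \<Rightarrow> 'a ell2 \<Rightarrow> 'a ell2" is "\<lambda>f g x. f x + g x"
  by (rule square_summable_plus)
lift_definition uminus_ell2 :: "'a ell2 \<Rightarrow> 'a ell2" is "\<lambda>f x. - f x" by simp
lift_definition minus_ell2 :: "'a ell2 \<Rightarrow> 'a ell2 \<Rightarrow> 'a ell2" is "\<lambda>f g x. f x - g x"
  subgoal for f g using square_summable_plus[of f "\<lambda>x. - g x"] by simp
  done
lift_definition scaleR_ell2 :: "real \<Rightarrow> 'a ell2 \<Rightarrow> 'a ell2" is "\<lambda>r f x. of_real r * f x"
  by (rule square_summable_cmult)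
lift_definition scaleC_ell2 :: "complex \<Rightarrow> 'a ell2 \<Rightarrow> 'a ell2" is "\<lambda>c f x. c * f x"
  by (rule square_summable_cmult)

instance
  by standard (transfer; auto simp: fun_eq_iff algebra_simps)+

end

lemmas ell2_coord_simps [simp] =
  zero_ell2.rep_eq plus_ell2.rep_eq uminus_ell2.rep_eq minus_ell2.rep_eq
  scaleR_ell2.rep_eq scaleC_ell2.rep_eq

lemma ell2_coord_sum [simp]: "ell2_coord (\<Sum>i\<in>I. f i) x = (\<Sum>i\<in>I. ell2_coord (f i) x)"
  by (induction I rule: infinite_finite_induct) auto

text \<open>Conjugate-linear in the first argument; its real part is the inner product of the class
  \<open>real_inner\<close> below.\<close>

definition cinner :: "'a ell2 \<Rightarrow> 'a ell2 \<Rightarrow> complex"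
  where "cinner f g = (\<Sum>\<^sub>\<infinity>x. cnj (ell2_coord f x) * ell2_coord g x)"

lemma cinner_summable:
  "(\<lambda>x. cnj (ell2_coord f x) * ell2_coord g x) summable_on A"
proof (rule abs_summable_summable, rule summable_on_comparison_test)
  show "(\<lambda>x. (cmod (ell2_coord f x))\<^sup>2 + (cmod (ell2_coord g x))\<^sup>2) summable_on A"
    by (intro summable_on_add ell2_summable)
  fix x
  show "cmod (cnj (ell2_coord f x) * ell2_coord g x)
      \<le> (cmod (ell2_coord f x))\<^sup>2 + (cmod (ell2_coord g x))\<^sup>2"
    using sum_squares_bound[of "cmod (ell2_coord f x)" "cmod (ell2_coord g x)"]
      mult_nonneg_nonneg[OF norm_ge_zero[of "ell2_coord f x"] norm_ge_zero[of "ell2_coord g x"]]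
    unfolding norm_mult complex_mod_cnj real_norm_def by linarith
qed auto

lemma cinner_add_left: "cinner (f + g) h = cinner f h + cinner g h"
  unfolding cinner_def
  by (subst infsum_add[symmetric]) (auto intro: cinner_summable simp: distrib_left distrib_right)

lemma cinner_add_right: "cinner h (f + g) = cinner h f + cinner h g"
  unfolding cinner_def
  by (subst infsum_add[symmetric]) (auto intro: cinner_summable simp: distrib_left distrib_right)

lemma cinner_scaleC_right: "cinner h (c *\<^sub>C f) = c * cinner h f"
  unfolding cinner_def infsum_cmult_right'[symmetric] by (simp add: algebra_simps)

lemma cinner_scaleC_left: "cinner (c *\<^sub>C f) h = cnj c * cinner f h"
  unfolding cinner_def infsum_cmult_right'[symmetric] by (simp add: algebra_simps)

lemma cinner_commute: "cinner f g = cnj (cinner g f)"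
  unfolding cinner_def infsum_cnj[symmetric] by (simp add: mult.commute)

lemma cinner_self: "cinner f f = of_real (\<Sum>\<^sub>\<infinity>x. (cmod (ell2_coord f x))\<^sup>2)"
proof -
  have "((\<lambda>x. complex_of_real ((cmod (ell2_coord f x))\<^sup>2)) has_sum
      of_real (\<Sum>\<^sub>\<infinity>x. (cmod (ell2_coord f x))\<^sup>2)) UNIV"
    by (rule has_sum_of_real[OF has_sum_infsum[OF ell2_summable]])
  then show ?thesis
    unfolding cinner_def complex_norm_square by (intro infsumI) (simp add: mult.commute)
qed

instantiation ell2 :: (type) real_inner
begin

definition inner_ell2 :: "'a ell2 \<Rightarrow> 'a ell2 \<Rightarrow> real"
  where "inner_ell2 f g = Re (cinner f g)"
definition norm_ell2 :: "'a ell2 \<Rightarrow> real"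
  where "norm_ell2 f = sqrt (\<Sum>\<^sub>\<infinity>x. (cmod (ell2_coord f x))\<^sup>2)"
definition dist_ell2 :: "'a ell2 \<Rightarrow> 'a ell2 \<Rightarrow> real"
  where "dist_ell2 f g = norm (f - g)"
definition sgn_ell2 :: "'a ell2 \<Rightarrow> 'a ell2"
  where "sgn_ell2 f = f /\<^sub>R norm f"
definition uniformity_ell2 :: "('a ell2 \<times> 'a ell2) filter"
  where "uniformity_ell2 = (INF e\<in>{0<..}. principal {(f, g). dist f g < e})"
definition open_ell2 :: "'a ell2 set \<Rightarrow> bool"
  where "open_ell2 U \<longleftrightarrow> (\<forall>x\<in>U. \<forall>\<^sub>F (x', y) in uniformity. x' = x \<longrightarrow> y \<in> U)"

lemma ell2_scaleR_scaleC: "r *\<^sub>R f = of_real r *\<^sub>C (f :: 'a ell2)"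
  by transfer simp

instance
proof
  fix f g h :: "'a ell2" and r :: real
  show "inner f g = inner g f"
    unfolding inner_ell2_def by (metis cinner_commute complex_cnj(1) complex.sel(1) cnj.sel(1))
  show "inner (f + g) h = inner f h + inner g h"
    by (simp add: inner_ell2_def cinner_add_left)
  show "inner (r *\<^sub>R f) g = r * inner f g"
    by (simp add: inner_ell2_def ell2_scaleR_scaleC cinner_scaleC_left)
  show "0 \<le> inner f f"
    by (simp add: inner_ell2_def cinner_self infsum_nonneg)
  show "inner f f = 0 \<longleftrightarrow> f = 0"
  proof
    assume "inner f f = 0"
    then have "(\<Sum>\<^sub>\<infinity>x. (cmod (ell2_coord f x))\<^sup>2) = 0"
      by (simp add: inner_ell2_def cinner_self)
    then have "(cmod (ell2_coord f x))\<^sup>2 = 0" for x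
      using nonneg_infsum_le_0D[of "\<lambda>x. (cmod (ell2_coord f x))\<^sup>2" UNIV x] ell2_summable[of f UNIV]
      by simp
    then show "f = 0" by (intro ell2_eqI) simp
  next
    assume "f = 0" then show "inner f f = 0" by (simp add: inner_ell2_def cinner_def)
  qed
  show "norm f = sqrt (inner f f)"
    by (simp add: norm_ell2_def inner_ell2_def cinner_self)
qed (rule dist_ell2_def sgn_ell2_def uniformity_ell2_def open_ell2_def)+

end

lemma norm_ell2_square: "(norm f)\<^sup>2 = (\<Sum>\<^sub>\<infinity>x. (cmod (ell2_coord f x))\<^sup>2)"
  by (simp add: norm_ell2_def infsum_nonneg)

lemma ell2_sum_le_norm:
  "finite F \<Longrightarrow> (\<Sum>x\<in>F. (cmod (ell2_coord f x))\<^sup>2) \<le> (norm f)\<^sup>2"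
  unfolding norm_ell2_square by (rule finite_sum_le_infsum) (auto simp: ell2_summable)

lemma ell2_coord_le_norm: "cmod (ell2_coord f x) \<le> norm f"
  using ell2_sum_le_norm[of "{x}" f] by (simp add: power2_le_iff_abs_le)

lemma ell2_norm_bound:
  assumes "\<And>F. finite F \<Longrightarrow> (\<Sum>x\<in>F. (cmod (ell2_coord f x))\<^sup>2) \<le> C\<^sup>2" "0 \<le> C"
  shows "norm f \<le> C"
proof -
  have "(norm f)\<^sup>2 \<le> C\<^sup>2"
    unfolding norm_ell2_square
    by (rule infsum_le_finite_sums) (use assms in \<open>auto simp: ell2_summable\<close>)
  then show ?thesis using assms(2) by (rule power2_le_imp_le)
qed

lemma norm_scaleC_ell2 [simp]: "norm (c *\<^sub>C (f :: 'a ell2)) = cmod c * norm f"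
  unfolding norm_ell2_def
  by (simp add: norm_mult power_mult_distrib infsum_cmult_right' real_sqrt_mult)

lemma scaleC_ell2_laws:
  fixes f g :: "'a ell2"
  shows "c *\<^sub>C (f + g) = c *\<^sub>C f + c *\<^sub>C g" "(c + d) *\<^sub>C f = c *\<^sub>C f + d *\<^sub>C f"
    "c *\<^sub>C d *\<^sub>C f = (c * d) *\<^sub>C f" "1 *\<^sub>C f = f" "c *\<^sub>C r *\<^sub>R f = r *\<^sub>R c *\<^sub>C f"
  by (auto intro!: ell2_eqI simp: algebra_simps)

lemma bounded_linear_scaleC_ell2: "bounded_linear (\<lambda>f :: 'a ell2. c *\<^sub>C f)"
  by (rule bounded_linear_intro[where K = "cmod c"]) (auto simp: scaleC_ell2_laws mult.commute)

lift_definition ket :: "'a \<Rightarrow> 'a ell2" is "\<lambda>a x. if x = a then 1 else 0"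
  subgoal for a
    by (rule finite_nonzero_values_imp_summable_on) (auto intro: finite_subset[of _ "{a}"])
  done

lemma ket_coord [simp]: "ell2_coord (ket a) x = (if x = a then 1 else 0)"
  by (simp add: ket.rep_eq)

lemma cinner_ket_left [simp]: "cinner (ket a) f = ell2_coord f a"
proof -
  have "cinner (ket a) f = (\<Sum>\<^sub>\<infinity>x\<in>{a}. cnj (ell2_coord (ket a) x) * ell2_coord f x)"
    unfolding cinner_def by (rule infsum_cong_neutral) auto
  then show ?thesis by simp
qed

lemma cinner_ket_right [simp]: "cinner f (ket a) = cnj (ell2_coord f a)"
  by (metis cinner_commute cinner_ket_left)

lemma norm_ket [simp]: "norm (ket a) = 1"
proof -
  have "of_real ((norm (ket a))\<^sup>2) = cinner (ket a) (ket a)"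
    unfolding norm_ell2_square cinner_self ..
  then have "(norm (ket a))\<^sup>2 = 1"
    unfolding cinner_ket_left ket_coord by (metis of_real_eq_1_iff)
  then have "norm (ket a) = 1 \<or> norm (ket a) = -1" by (rule power2_eq_1_iff[THEN iffD1])
  then show ?thesis using norm_ge_zero[of "ket a"] by linarith
qed

lemma ell2_has_sum: "((\<lambda>a. ell2_coord f a *\<^sub>C ket a) has_sum f) UNIV"
  unfolding has_sum_def tendsto_iff eventually_finite_subsets_at_top
proof (intro allI impI)
  fix e :: real assume e: "e > 0"
  have "((\<lambda>x. (cmod (ell2_coord f x))\<^sup>2) has_sum (norm f)\<^sup>2) UNIV"
    unfolding norm_ell2_square by (rule has_sum_infsum[OF ell2_summable])
  then have "\<forall>\<^sub>F Y in finite_subsets_at_top UNIV.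
      dist (\<Sum>x\<in>Y. (cmod (ell2_coord f x))\<^sup>2) ((norm f)\<^sup>2) < (e/2)\<^sup>2"
    unfolding has_sum_def by (rule tendstoD) (use e in simp)
  then obtain X where X: "finite X"
    "\<And>Y. finite Y \<Longrightarrow> X \<subseteq> Y \<Longrightarrow> dist (\<Sum>x\<in>Y. (cmod (ell2_coord f x))\<^sup>2) ((norm f)\<^sup>2) < (e/2)\<^sup>2"
    unfolding eventually_finite_subsets_at_top by auto
  show "\<exists>X. finite X \<and> X \<subseteq> UNIV \<and>
      (\<forall>Y. finite Y \<and> X \<subseteq> Y \<and> Y \<subseteq> UNIV \<longrightarrow> dist (\<Sum>a\<in>Y. ell2_coord f a *\<^sub>C ket a) f < e)"
  proof (intro exI[of _ X] conjI allI impI X(1) subset_UNIV)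
    fix Y assume Y: "finite Y \<and> X \<subseteq> Y \<and> Y \<subseteq> UNIV"
    let ?g = "f - (\<Sum>a\<in>Y. ell2_coord f a *\<^sub>C ket a)"
    have g: "ell2_coord ?g x = (if x \<in> Y then 0 else ell2_coord f x)" for x
    proof -
      have "(\<Sum>a\<in>Y. ell2_coord f a * (if x = a then 1 else 0)) = (\<Sum>a\<in>Y. if x = a then ell2_coord f a else 0)"
        by (rule sum.cong) auto
      then show ?thesis using Y by (simp add: sum.delta)
    qed
    have "norm ?g \<le> e/2"
    proof (rule ell2_norm_bound)
      fix F :: "'a set" assume F: "finite F"
      have "(\<Sum>x\<in>F. (cmod (ell2_coord ?g x))\<^sup>2) = (\<Sum>x\<in>F-Y. (cmod (ell2_coord f x))\<^sup>2)"
        unfolding g using F by (intro sum.mono_neutral_cong_right) auto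
      also have "\<dots> = (\<Sum>x\<in>F\<union>Y. (cmod (ell2_coord f x))\<^sup>2) - (\<Sum>x\<in>Y. (cmod (ell2_coord f x))\<^sup>2)"
      proof -
        have "(\<Sum>x\<in>(F-Y)\<union>Y. (cmod (ell2_coord f x))\<^sup>2)
            = (\<Sum>x\<in>F-Y. (cmod (ell2_coord f x))\<^sup>2) + (\<Sum>x\<in>Y. (cmod (ell2_coord f x))\<^sup>2)"
          using F Y by (intro sum.union_disjoint) auto
        then show ?thesis by (simp only: Un_Diff_cancel2)
      qed
      also have "\<dots> \<le> (norm f)\<^sup>2 - (\<Sum>x\<in>Y. (cmod (ell2_coord f x))\<^sup>2)"
        using ell2_sum_le_norm[of "F \<union> Y" f] F Y by simp
      also have "\<dots> \<le> (e/2)\<^sup>2"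
      proof -
        have "dist (\<Sum>x\<in>Y. (cmod (ell2_coord f x))\<^sup>2) ((norm f)\<^sup>2) < (e/2)\<^sup>2"
          using Y by (intro X(2)) auto
        then show ?thesis unfolding dist_real_def by linarith
      qed
      finally show "(\<Sum>x\<in>F. (cmod (ell2_coord ?g x))\<^sup>2) \<le> (e/2)\<^sup>2" .
    qed (use e in simp)
    then show "dist (\<Sum>a\<in>Y. ell2_coord f a *\<^sub>C ket a) f < e"
      using e by (simp add: dist_norm norm_minus_commute)
  qed
qed

lemma bounded_linear_ell2_eqI:
  assumes "bounded_linear S" "bounded_linear T"
    and "\<And>c a. S (c *\<^sub>C ket a) = T (c *\<^sub>C ket a)"
  shows "S f = T f"
proof -
  have "((\<lambda>a. S (ell2_coord f a *\<^sub>C ket a)) has_sum S f) UNIV"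
    using has_sum_bounded_linear[OF assms(1) ell2_has_sum[of f]] by (simp add: o_def)
  moreover have "((\<lambda>a. S (ell2_coord f a *\<^sub>C ket a)) has_sum T f) UNIV"
    using has_sum_bounded_linear[OF assms(2) ell2_has_sum[of f]] by (simp add: o_def assms(3))
  ultimately show ?thesis by (rule has_sum_unique)
qed

lemma cinner_norm_le: "cmod (cinner f g) \<le> norm f * norm g"
proof (cases "cinner f g = 0")
  case False
  let ?z = "cinner f g"
  have "cmod ?z * cmod ?z = Re (cnj ?z * ?z)"
    by (metis complex_norm_square power2_eq_square Re_complex_of_real mult.commute of_real_power)
  also have "\<dots> = inner (?z *\<^sub>C f) g"
    by (simp add: inner_ell2_def cinner_scaleC_left)
  also have "\<dots> \<le> norm (?z *\<^sub>C f) * norm g" by (rule norm_cauchy_schwarz)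
  finally show ?thesis using False by (simp add: mult.assoc)
qed simp

lemma bounded_linear_cinner_right: "bounded_linear (cinner f)"
proof (rule bounded_linear_intro[where K = "norm f"])
  show "norm (cinner f g) \<le> norm g * norm f" for g
    using cinner_norm_le[of f g] by (simp add: mult.commute)
qed (simp_all add: cinner_add_right cinner_scaleC_right ell2_scaleR_scaleC scaleR_conv_of_real)

section \<open>Bounded operators\<close>

text \<open>Real-linear bounded maps come from the library; commuting with complex scalars singles out
  \<open>B(\<ell>\<^sup>2(X))\<close>, and the norm is the operator norm.\<close>

typedef 'a ell2_op = "{T :: 'a ell2 \<Rightarrow>\<^sub>L 'a ell2. \<forall>c x. T (c *\<^sub>C x) = c *\<^sub>C T x}"
  morphisms blinfun_of_op Abs_ell2_op
  by (rule exI[of _ 0]) (auto intro!: ell2_eqI)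

lifting_forget ell2.lifting
setup_lifting type_definition_ell2_op

lift_definition op_apply :: "'a ell2_op \<Rightarrow> 'a ell2 \<Rightarrow> 'a ell2" is blinfun_apply .

definition mk_op :: "('a ell2 \<Rightarrow> 'a ell2) \<Rightarrow> 'a ell2_op"
  where "mk_op F = Abs_ell2_op (Blinfun F)"

lemma op_apply_mk_op:
  assumes "bounded_linear F" "\<And>c x. F (c *\<^sub>C x) = c *\<^sub>C F x"
  shows "op_apply (mk_op F) x = F x"
  unfolding mk_op_def op_apply.rep_eq
  by (subst Abs_ell2_op_inverse) (auto simp: bounded_linear_Blinfun_apply[OF assms(1)] assms(2))

lemma op_eqI: "(\<And>x. op_apply S x = op_apply T x) \<Longrightarrow> S = T"
  by transfer (rule blinfun_eqI)

lemma bounded_linear_op_apply: "bounded_linear (op_apply T)"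
  by transfer (rule blinfun.bounded_linear_right)

lemma op_apply_scaleC: "op_apply T (c *\<^sub>C x) = c *\<^sub>C op_apply T x"
  by transfer simp

lemma op_ext_ket: "(\<And>a. op_apply S (ket a) = op_apply T (ket a)) \<Longrightarrow> S = T"
  by (rule op_eqI, rule bounded_linear_ell2_eqI[OF bounded_linear_op_apply bounded_linear_op_apply])
     (simp add: op_apply_scaleC)

text \<open>Only the algebraic structure is a class: it has to apply both to operators and, pointwise,
  to functions with values in operators.\<close>

class complex_star_algebra = ring_1 + scaleC +
  fixes star :: "'a \<Rightarrow> 'a"
  assumes scaleC_add_right: "c *\<^sub>C (x + y) = c *\<^sub>C x + c *\<^sub>C y"
    and scaleC_add_left: "(c + d) *\<^sub>C x = c *\<^sub>C x + d *\<^sub>C x"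
    and scaleC_scaleC: "c *\<^sub>C d *\<^sub>C x = (c * d) *\<^sub>C x"
    and scaleC_one: "1 *\<^sub>C x = x"
    and mult_scaleC_left: "(c *\<^sub>C x) * y = c *\<^sub>C (x * y)"
    and mult_scaleC_right: "x * (c *\<^sub>C y) = c *\<^sub>C (x * y)"
    and star_star: "star (star x) = x"
    and star_add: "star (x + y) = star x + star y"
    and star_scaleC: "star (c *\<^sub>C x) = cnj c *\<^sub>C star x"
    and star_mult: "star (x * y) = star y * star x"

instantiation ell2_op :: (type) real_normed_algebra_1
begin

lift_definition zero_ell2_op :: "'a ell2_op" is 0 by (auto intro: ell2_eqI)
lift_definition one_ell2_op :: "'a ell2_op" is id_blinfun by simp
lift_definition plus_ell2_op :: "'a ell2_op \<Rightarrow> 'a ell2_op \<Rightarrow> 'a ell2_op" is "(+)"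
  by (simp add: blinfun.add_left scaleC_ell2_laws)
lift_definition uminus_ell2_op :: "'a ell2_op \<Rightarrow> 'a ell2_op" is uminus
  by (auto simp: blinfun.minus_left intro: ell2_eqI)
lift_definition minus_ell2_op :: "'a ell2_op \<Rightarrow> 'a ell2_op \<Rightarrow> 'a ell2_op" is "(-)"
  by (auto simp: blinfun.diff_left algebra_simps intro: ell2_eqI)
lift_definition times_ell2_op :: "'a ell2_op \<Rightarrow> 'a ell2_op \<Rightarrow> 'a ell2_op" is blinfun_compose
  by simp
lift_definition scaleR_ell2_op :: "real \<Rightarrow> 'a ell2_op \<Rightarrow> 'a ell2_op" is scaleR
  by (simp add: blinfun.scaleR_left scaleC_ell2_laws)
lift_definition norm_ell2_op :: "'a ell2_op \<Rightarrow> real" is norm .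
definition dist_ell2_op :: "'a ell2_op \<Rightarrow> 'a ell2_op \<Rightarrow> real"
  where "dist_ell2_op S T = norm (S - T)"
definition sgn_ell2_op :: "'a ell2_op \<Rightarrow> 'a ell2_op"
  where "sgn_ell2_op T = scaleR (inverse (norm T)) T"
definition uniformity_ell2_op :: "('a ell2_op \<times> 'a ell2_op) filter"
  where "uniformity_ell2_op = (INF e\<in>{0<..}. principal {(S, T). dist S T < e})"
definition open_ell2_op :: "'a ell2_op set \<Rightarrow> bool"
  where "open_ell2_op U \<longleftrightarrow> (\<forall>x\<in>U. \<forall>\<^sub>F (x', y) in uniformity. x' = x \<longrightarrow> y \<in> U)"

instance
proof
  fix R S T :: "'a ell2_op" and r s :: real
  show "norm (R * S) \<le> norm R * norm S" by transfer (rule norm_blinfun_compose)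
  show "norm (1 :: 'a ell2_op) = 1"
  proof (rule antisym)
    show "norm (1 :: 'a ell2_op) \<le> 1"
      by transfer (rule norm_blinfun_id_le)
    have "norm (id_blinfun (ket (undefined :: 'a))) \<le> norm (id_blinfun :: 'a ell2 \<Rightarrow>\<^sub>L _) * norm (ket (undefined :: 'a))"
      by (rule norm_blinfun)
    then show "1 \<le> norm (1 :: 'a ell2_op)" by transfer simp
  qed
  show "(0 :: 'a ell2_op) \<noteq> 1"
  proof
    assume "(0 :: 'a ell2_op) = 1"
    then have "(0 :: 'a ell2 \<Rightarrow>\<^sub>L 'a ell2) (ket undefined) = id_blinfun (ket undefined)" by transfer simp
    then have "norm (ket (undefined :: 'a)) = 0" by simp
    then show False by simp
  qed
  show "norm (R + S) \<le> norm R + norm S" by transfer (rule norm_triangle_ineq)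
  show "norm (r *\<^sub>R S) = \<bar>r\<bar> * norm S" by transfer (rule norm_scaleR)
  show "norm S = 0 \<longleftrightarrow> S = 0" by transfer (rule norm_eq_zero)
  show "R * S * T = R * (S * T)" by transfer (simp add: blinfun_eqI)
  show "(R + S) * T = R * T + S * T" by transfer (simp add: blinfun_eqI blinfun.add_left)
  show "R * (S + T) = R * S + R * T" by transfer (simp add: blinfun_eqI blinfun.add_left blinfun.add_right)
  show "r *\<^sub>R R * S = r *\<^sub>R (R * S)" by transfer (simp add: blinfun_eqI blinfun.scaleR_left)
  show "R * r *\<^sub>R S = r *\<^sub>R (R * S)"
    by transfer (simp add: blinfun_eqI blinfun.scaleR_left blinfun.scaleR_right)
  show "1 * R = R" "R * 1 = R" by (transfer; simp add: blinfun_eqI)+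
  show "R + S + T = R + (S + T)" "R + S = S + R" "0 + R = R" "- R + R = 0" "R - S = R + - S"
    by (transfer; simp)+
  show "r *\<^sub>R (R + S) = r *\<^sub>R R + r *\<^sub>R S" "(r + s) *\<^sub>R R = r *\<^sub>R R + s *\<^sub>R R"
    "r *\<^sub>R s *\<^sub>R R = (r * s) *\<^sub>R R" "1 *\<^sub>R R = R"
    by (transfer; simp add: algebra_simps)+
qed (rule dist_ell2_op_def sgn_ell2_op_def uniformity_ell2_op_def open_ell2_op_def)+

end

lemma op_apply_ops [simp]:
  "op_apply 0 x = 0" "op_apply 1 x = x" "op_apply (S + T) x = op_apply S x + op_apply T x"
  "op_apply (- S) x = - op_apply S x" "op_apply (S - T) x = op_apply S x - op_apply T x"
  "op_apply (S * T) x = op_apply S (op_apply T x)" "op_apply (r *\<^sub>R T) x = r *\<^sub>R op_apply T x"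
  by (transfer; simp add: blinfun.bilinear_simps)+

lemma norm_op_apply: "norm (op_apply T x) \<le> norm T * norm x"
  by transfer (rule norm_blinfun)

lemma norm_op_bound:
  "0 \<le> C \<Longrightarrow> (\<And>x. norm (op_apply T x) \<le> C * norm x) \<Longrightarrow> norm T \<le> C"
  by transfer (rule norm_blinfun_bound)

lemma ket_combination_norm:
  assumes "finite F"
  shows "norm (\<Sum>a\<in>F. c a *\<^sub>C ket a) = sqrt (\<Sum>a\<in>F. (cmod (c a))\<^sup>2)"
proof -
  have c: "ell2_coord (\<Sum>a\<in>F. c a *\<^sub>C ket a) x = (if x \<in> F then c x else 0)" for x
  proof -
    have "(\<Sum>a\<in>F. c a * (if x = a then 1 else 0)) = (\<Sum>a\<in>F. if x = a then c a else 0)"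
      by (rule sum.cong) auto
    then show ?thesis using assms by simp
  qed
  have "(\<Sum>\<^sub>\<infinity>x. (cmod (ell2_coord (\<Sum>a\<in>F. c a *\<^sub>C ket a) x))\<^sup>2) = (\<Sum>\<^sub>\<infinity>x\<in>F. (cmod (c x))\<^sup>2)"
    unfolding c by (rule infsum_cong_neutral) auto
  then show ?thesis unfolding norm_ell2_def using assms by simp
qed

lemma cinner_sum_left: "cinner (\<Sum>a\<in>F. f a) g = (\<Sum>a\<in>F. cinner (f a) g)"
proof (induction F rule: infinite_finite_induct)
  case (insert a F) then show ?case by (simp add: cinner_add_left)
qed (simp_all add: cinner_def)

lemma adjoint_coord_bound:
  assumes "finite F"
  shows "(\<Sum>a\<in>F. (cmod (cinner (op_apply T (ket a)) x))\<^sup>2) \<le> (norm T * norm x)\<^sup>2"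
proof -
  define c where "c a = cinner (op_apply T (ket a)) x" for a
  let ?s = "\<Sum>a\<in>F. (cmod (c a))\<^sup>2"
  let ?v = "\<Sum>a\<in>F. c a *\<^sub>C ket a"
  interpret bounded_linear "op_apply T" by (rule bounded_linear_op_apply)
  have s0: "0 \<le> ?s" by (simp add: sum_nonneg)
  have "of_real ?s = cinner (op_apply T ?v) x"
    unfolding sum op_apply_scaleC cinner_sum_left cinner_scaleC_left c_def[symmetric]
    by (simp only: of_real_sum complex_norm_square mult.commute)
  then have "?s = cmod (cinner (op_apply T ?v) x)"
    using s0 by (metis abs_of_nonneg norm_of_real)
  also have "\<dots> \<le> norm (op_apply T ?v) * norm x" by (rule cinner_norm_le)
  also have "\<dots> \<le> norm T * norm ?v * norm x"
    by (intro mult_right_mono norm_op_apply) simp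
  also have "\<dots> = (norm T * norm x) * sqrt ?s"
    using ket_combination_norm[OF assms, of c] by simp
  finally have *: "sqrt ?s * sqrt ?s \<le> (norm T * norm x) * sqrt ?s"
    using s0 by simp
  have "sqrt ?s \<le> norm T * norm x"
  proof (cases "sqrt ?s = 0")
    case False
    then have "0 < sqrt ?s" using s0 by (metis less_eq_real_def real_sqrt_ge_0_iff)
    with * show ?thesis by (metis mult_le_cancel_right_pos)
  qed simp
  then have "(sqrt ?s)\<^sup>2 \<le> (norm T * norm x)\<^sup>2" by (intro power_mono) (use s0 in auto)
  then show ?thesis using s0 by (simp add: c_def)
qed

text \<open>The adjoint is given by its coordinates \<open>(T\<^sup>*x)(a) = \<langle>\<delta>\<^sub>a, T\<^sup>*x\<rangle> = \<langle>T\<delta>\<^sub>a, x\<rangle>\<close>.\<close>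

definition adjoint_apply :: "'a ell2_op \<Rightarrow> 'a ell2 \<Rightarrow> 'a ell2"
  where "adjoint_apply T x = Abs_ell2 (\<lambda>a. cinner (op_apply T (ket a)) x)"

lemma adjoint_apply_coord: "ell2_coord (adjoint_apply T x) a = cinner (op_apply T (ket a)) x"
  unfolding adjoint_apply_def
  by (subst Abs_ell2_inverse) (auto intro: square_summable_bound adjoint_coord_bound)

lemma norm_adjoint_apply: "norm (adjoint_apply T x) \<le> norm T * norm x"
  by (rule ell2_norm_bound) (auto simp: adjoint_apply_coord intro: adjoint_coord_bound)

lemma bounded_linear_adjoint_apply: "bounded_linear (adjoint_apply T)"
proof (rule bounded_linear_intro[where K = "norm T"])
  show "norm (adjoint_apply T x) \<le> norm x * norm T" for x
    using norm_adjoint_apply[of T x] by (simp add: mult.commute)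
qed (auto intro!: ell2_eqI
      simp: adjoint_apply_coord cinner_add_right cinner_scaleC_right ell2_scaleR_scaleC)

definition op_adjoint :: "'a ell2_op \<Rightarrow> 'a ell2_op"
  where "op_adjoint T = mk_op (adjoint_apply T)"

lemma op_apply_adjoint: "op_apply (op_adjoint T) x = adjoint_apply T x"
  unfolding op_adjoint_def
  by (rule op_apply_mk_op[OF bounded_linear_adjoint_apply])
     (auto intro!: ell2_eqI simp: adjoint_apply_coord cinner_scaleC_right)

lemma cinner_adjoint: "cinner (op_apply (op_adjoint T) x) y = cinner x (op_apply T y)"
proof (rule bounded_linear_ell2_eqI[where S = "cinner (op_apply (op_adjoint T) x)"])
  show "bounded_linear (cinner (op_apply (op_adjoint T) x))" by (rule bounded_linear_cinner_right)
  show "bounded_linear (\<lambda>y. cinner x (op_apply T y))"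
    by (intro bounded_linear_compose[OF bounded_linear_cinner_right] bounded_linear_op_apply)
  show "cinner (op_apply (op_adjoint T) x) (c *\<^sub>C ket a) = cinner x (op_apply T (c *\<^sub>C ket a))" for c a
    by (simp add: op_apply_scaleC cinner_scaleC_right op_apply_adjoint adjoint_apply_coord
        cinner_commute[of x])
qed

lemma cinner_adjoint': "cinner (op_apply T x) y = cinner x (op_apply (op_adjoint T) y)"
proof -
  have "cinner (op_apply T x) y = cnj (cinner y (op_apply T x))" by (rule cinner_commute)
  also have "\<dots> = cnj (cinner (op_apply (op_adjoint T) y) x)" by (simp only: cinner_adjoint)
  also have "\<dots> = cinner x (op_apply (op_adjoint T) y)" by (rule cinner_commute[symmetric])
  finally show ?thesis .
qed

lemma cinner_eqI: "(\<And>x. cinner x y = cinner x z) \<Longrightarrow> y = z"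
  by (rule ell2_eqI) (simp only: cinner_ket_left[symmetric])

lemma adjoint_unique:
  assumes "\<And>x y. cinner (op_apply T x) y = cinner x (op_apply S y)"
  shows "S = op_adjoint T"
  by (intro op_eqI cinner_eqI) (simp only: assms[symmetric] cinner_adjoint')

instantiation ell2_op :: (type) complex_star_algebra
begin

definition scaleC_ell2_op :: "complex \<Rightarrow> 'a ell2_op \<Rightarrow> 'a ell2_op"
  where "scaleC_ell2_op c T = mk_op (\<lambda>x. c *\<^sub>C op_apply T x)"
definition star_ell2_op :: "'a ell2_op \<Rightarrow> 'a ell2_op"
  where "star_ell2_op T = op_adjoint T"

lemma op_apply_scaleC_op [simp]: "op_apply (c *\<^sub>C T) x = c *\<^sub>C op_apply T x"
  unfolding scaleC_ell2_op_def
  by (rule op_apply_mk_op[OF bounded_linear_compose[OF bounded_linear_scaleC_ell2 bounded_linear_op_apply]])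
     (simp add: op_apply_scaleC scaleC_ell2_laws mult.commute)

instance
proof
  fix c d :: complex and S T :: "'a ell2_op"
  show "c *\<^sub>C (S + T) = c *\<^sub>C S + c *\<^sub>C T" "(c + d) *\<^sub>C S = c *\<^sub>C S + d *\<^sub>C S"
    "c *\<^sub>C d *\<^sub>C S = (c * d) *\<^sub>C S" "1 *\<^sub>C S = S" "c *\<^sub>C S * T = c *\<^sub>C (S * T)"
    "S * c *\<^sub>C T = c *\<^sub>C (S * T)"
    by (auto intro!: op_eqI simp: scaleC_ell2_laws op_apply_scaleC)
  show "star (star S) = S"
    unfolding star_ell2_op_def by (rule adjoint_unique[symmetric]) (rule cinner_adjoint)
  show "star (S + T) = star S + star T"
    unfolding star_ell2_op_def
    by (rule adjoint_unique[symmetric]) (simp add: cinner_add_left cinner_add_right cinner_adjoint')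
  show "star (c *\<^sub>C S) = cnj c *\<^sub>C star S"
    unfolding star_ell2_op_def
    by (rule adjoint_unique[symmetric]) (simp add: cinner_scaleC_left cinner_scaleC_right cinner_adjoint')
  show "star (S * T) = star T * star S"
    unfolding star_ell2_op_def
    by (rule adjoint_unique[symmetric]) (simp add: cinner_adjoint')
qed

end

instantiation "fun" :: (type, complex_star_algebra) complex_star_algebra
begin

definition scaleC_fun :: "complex \<Rightarrow> ('a \<Rightarrow> 'b) \<Rightarrow> 'a \<Rightarrow> 'b"
  where "scaleC_fun c f = (\<lambda>t. c *\<^sub>C f t)"
definition star_fun :: "('a \<Rightarrow> 'b) \<Rightarrow> 'a \<Rightarrow> 'b"
  where "star_fun f = (\<lambda>t. star (f t))"

instance
  by standard
     (auto simp: fun_eq_iff scaleC_fun_def star_fun_def scaleC_add_right scaleC_add_left scaleC_scaleC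
       scaleC_one mult_scaleC_left mult_scaleC_right star_star star_add star_scaleC star_mult)

end

section \<open>Tensor products of operators\<close>

text \<open>Throughout, \<open>\<ell>\<^sup>2(X) \<otimes> \<ell>\<^sup>2(Y)\<close> is identified with \<open>\<ell>\<^sup>2(X \<times> Y)\<close>.\<close>

definition ell2_reindex :: "('b \<Rightarrow> 'a) \<Rightarrow> 'a ell2 \<Rightarrow> 'b ell2"
  where "ell2_reindex \<pi> f = Abs_ell2 (\<lambda>x. ell2_coord f (\<pi> x))"

lemma ell2_reindex_coord:
  assumes "inj \<pi>"
  shows "ell2_coord (ell2_reindex \<pi> f) x = ell2_coord f (\<pi> x)"
proof -
  have "(\<lambda>x. (cmod (ell2_coord f (\<pi> x)))\<^sup>2) summable_on UNIV"
    using summable_on_reindex[OF assms, of "\<lambda>x. (cmod (ell2_coord f x))\<^sup>2"]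
    by (simp add: ell2_summable o_def)
  then show ?thesis by (simp add: ell2_reindex_def Abs_ell2_inverse)
qed

lemma norm_ell2_reindex:
  assumes "inj \<pi>"
  shows "norm (ell2_reindex \<pi> f) \<le> norm f"
proof (rule ell2_norm_bound)
  fix F :: "'a set" assume F: "finite F"
  have "(\<Sum>x\<in>F. (cmod (ell2_coord (ell2_reindex \<pi> f) x))\<^sup>2) = (\<Sum>x\<in>\<pi> ` F. (cmod (ell2_coord f x))\<^sup>2)"
    using assms by (subst sum.reindex) (auto simp: ell2_reindex_coord inj_on_def)
  also have "\<dots> \<le> (norm f)\<^sup>2" using F by (intro ell2_sum_le_norm) simp
  finally show "(\<Sum>x\<in>F. (cmod (ell2_coord (ell2_reindex \<pi> f) x))\<^sup>2) \<le> (norm f)\<^sup>2" .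
qed simp

lemma ell2_reindex_scaleC: "inj \<pi> \<Longrightarrow> ell2_reindex \<pi> (c *\<^sub>C f) = c *\<^sub>C ell2_reindex \<pi> f"
  by (rule ell2_eqI) (simp add: ell2_reindex_coord)

lemma bounded_linear_ell2_reindex: "inj \<pi> \<Longrightarrow> bounded_linear (ell2_reindex \<pi>)"
  by (rule bounded_linear_intro[where K = 1])
     (auto intro!: ell2_eqI simp: ell2_reindex_coord norm_ell2_reindex)

lemma ell2_reindex_ket: "bij \<pi> \<Longrightarrow> ell2_reindex \<pi> (ket a) = ket (inv \<pi> a)"
  by (rule ell2_eqI) (auto simp: ell2_reindex_coord bij_is_inj bij_is_surj surj_f_inv_f)

text \<open>Conjugation by the unitary that a bijection of the index sets induces.\<close>

definition op_reindex :: "('b \<Rightarrow> 'a) \<Rightarrow> 'a ell2_op \<Rightarrow> 'b ell2_op"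
  where "op_reindex \<pi> T = mk_op (\<lambda>f. ell2_reindex \<pi> (op_apply T (ell2_reindex (inv \<pi>) f)))"

lemma op_apply_reindex:
  assumes "bij \<pi>"
  shows "op_apply (op_reindex \<pi> T) f = ell2_reindex \<pi> (op_apply T (ell2_reindex (inv \<pi>) f))"
  unfolding op_reindex_def
proof (rule op_apply_mk_op)
  have "inj \<pi>" "inj (inv \<pi>)" using assms by (auto intro: bij_is_inj bij_imp_bij_inv)
  then show "bounded_linear (\<lambda>f. ell2_reindex \<pi> (op_apply T (ell2_reindex (inv \<pi>) f)))"
    using bounded_linear_compose[OF bounded_linear_ell2_reindex
        bounded_linear_compose[OF bounded_linear_op_apply bounded_linear_ell2_reindex]] by blast
  show "ell2_reindex \<pi> (op_apply T (ell2_reindex (inv \<pi>) (c *\<^sub>C x)))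
      = c *\<^sub>C ell2_reindex \<pi> (op_apply T (ell2_reindex (inv \<pi>) x))" for c x
    using \<open>inj \<pi>\<close> \<open>inj (inv \<pi>)\<close> by (simp add: ell2_reindex_scaleC op_apply_scaleC)
qed

lemma op_reindex_ket_coord:
  assumes "bij \<pi>"
  shows "ell2_coord (op_apply (op_reindex \<pi> T) (ket a)) b = ell2_coord (op_apply T (ket (\<pi> a))) (\<pi> b)"
  using assms
  by (simp add: op_apply_reindex ell2_reindex_coord bij_is_inj ell2_reindex_ket bij_imp_bij_inv inv_inv_eq)

definition ell2_slice :: "('a \<times> 'b) ell2 \<Rightarrow> 'b \<Rightarrow> 'a ell2"
  where "ell2_slice f y = ell2_reindex (\<lambda>x. (x, y)) f"

lemma ell2_slice_coord [simp]: "ell2_coord (ell2_slice f y) x = ell2_coord f (x, y)"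
  by (simp add: ell2_slice_def ell2_reindex_coord inj_def)

lemma ell2_slice_add: "ell2_slice (f + g) y = ell2_slice f y + ell2_slice g y"
  and ell2_slice_scaleR: "ell2_slice (r *\<^sub>R f) y = r *\<^sub>R ell2_slice f y"
  and ell2_slice_scaleC: "ell2_slice (c *\<^sub>C f) y = c *\<^sub>C ell2_slice f y"
  by (auto intro!: ell2_eqI)

lemma has_sum_finite_sum:
  fixes f :: "'a \<Rightarrow> 'b \<Rightarrow> 'c::topological_comm_monoid_add"
  assumes "finite Y" "\<And>y. y \<in> Y \<Longrightarrow> (f y has_sum s y) A"
  shows "((\<lambda>x. \<Sum>y\<in>Y. f y x) has_sum (\<Sum>y\<in>Y. s y)) A"
  using assms by (induction Y rule: finite_induct) (auto intro!: has_sum_add)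

lemma sum_norm_ell2_slice:
  fixes f :: "('a \<times> 'b) ell2"
  assumes "finite Y"
  shows "(\<Sum>y\<in>Y. (norm (ell2_slice f y))\<^sup>2) \<le> (norm f)\<^sup>2"
proof -
  have "((\<lambda>x. (cmod (ell2_coord f (x, y)))\<^sup>2) has_sum (norm (ell2_slice f y))\<^sup>2) UNIV" for y
    using has_sum_infsum[OF ell2_summable[of "ell2_slice f y" UNIV]] by (simp add: norm_ell2_square)
  then have s: "((\<lambda>x. \<Sum>y\<in>Y. (cmod (ell2_coord f (x, y)))\<^sup>2) has_sum (\<Sum>y\<in>Y. (norm (ell2_slice f y))\<^sup>2)) UNIV"
    by (intro has_sum_finite_sum assms)
  then have "(\<Sum>y\<in>Y. (norm (ell2_slice f y))\<^sup>2) = (\<Sum>\<^sub>\<infinity>x. \<Sum>y\<in>Y. (cmod (ell2_coord f (x, y)))\<^sup>2)"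
    by (rule infsumI[symmetric])
  also have "\<dots> \<le> (norm f)\<^sup>2"
  proof (rule infsum_le_finite_sums)
    show "(\<lambda>x. \<Sum>y\<in>Y. (cmod (ell2_coord f (x, y)))\<^sup>2) summable_on UNIV"
      using s by (rule has_sum_imp_summable)
    fix F :: "'a set" assume F: "finite F"
    have "(\<Sum>x\<in>F. \<Sum>y\<in>Y. (cmod (ell2_coord f (x, y)))\<^sup>2) = (\<Sum>z\<in>F \<times> Y. (cmod (ell2_coord f z))\<^sup>2)"
      by (simp add: sum.cartesian_product)
    also have "\<dots> \<le> (norm f)\<^sup>2"
      using F assms by (intro ell2_sum_le_norm) simp
    finally show "(\<Sum>x\<in>F. \<Sum>y\<in>Y. (cmod (ell2_coord f (x, y)))\<^sup>2) \<le> (norm f)\<^sup>2" .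
  qed
  finally show ?thesis .
qed

text \<open>\<open>amplify T\<close> is \<open>T \<otimes> 1\<close>: it applies \<open>T\<close> to every slice \<open>f(\<cdot>, y)\<close>.\<close>

definition amplify_apply :: "'a ell2_op \<Rightarrow> ('a \<times> 'b) ell2 \<Rightarrow> ('a \<times> 'b) ell2"
  where "amplify_apply T f = Abs_ell2 (\<lambda>(x, y). ell2_coord (op_apply T (ell2_slice f y)) x)"

lemma amplify_bound:
  fixes f :: "('a \<times> 'b) ell2"
  assumes "finite F"
  shows "(\<Sum>(x, y)\<in>F. (cmod (ell2_coord (op_apply T (ell2_slice f y)) x))\<^sup>2) \<le> (norm T * norm f)\<^sup>2"
proof -
  have "(\<Sum>(x, y)\<in>F. (cmod (ell2_coord (op_apply T (ell2_slice f y)) x))\<^sup>2)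
      \<le> (\<Sum>(x, y)\<in>fst ` F \<times> snd ` F. (cmod (ell2_coord (op_apply T (ell2_slice f y)) x))\<^sup>2)"
    using assms by (intro sum_mono2) (auto simp: rev_image_eqI)
  also have "\<dots> = (\<Sum>y\<in>snd ` F. \<Sum>x\<in>fst ` F. (cmod (ell2_coord (op_apply T (ell2_slice f y)) x))\<^sup>2)"
    unfolding sum.cartesian_product[symmetric] by (rule sum.swap)
  also have "\<dots> \<le> (\<Sum>y\<in>snd ` F. (norm T)\<^sup>2 * (norm (ell2_slice f y))\<^sup>2)"
  proof (rule sum_mono)
    fix y
    have "(\<Sum>x\<in>fst ` F. (cmod (ell2_coord (op_apply T (ell2_slice f y)) x))\<^sup>2)
        \<le> (norm (op_apply T (ell2_slice f y)))\<^sup>2"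
      using assms by (intro ell2_sum_le_norm) simp
    also have "\<dots> \<le> (norm T * norm (ell2_slice f y))\<^sup>2"
      by (intro power_mono norm_op_apply) simp
    finally show "(\<Sum>x\<in>fst ` F. (cmod (ell2_coord (op_apply T (ell2_slice f y)) x))\<^sup>2)
        \<le> (norm T)\<^sup>2 * (norm (ell2_slice f y))\<^sup>2"
      by (simp only: power_mult_distrib)
  qed
  also have "\<dots> \<le> (norm T)\<^sup>2 * (norm f)\<^sup>2"
    unfolding sum_distrib_left[symmetric]
    using assms by (intro mult_left_mono sum_norm_ell2_slice) auto
  finally show ?thesis by (simp only: power_mult_distrib)
qed

lemma amplify_apply_coord:
  "ell2_coord (amplify_apply T f) z = ell2_coord (op_apply T (ell2_slice f (snd z))) (fst z)"
proof -
  have "(\<lambda>z. (cmod (case z of (x, y) \<Rightarrow> ell2_coord (op_apply T (ell2_slice f y)) x))\<^sup>2) summable_on UNIV"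
    by (rule square_summable_bound) (use amplify_bound[of _ T f] in \<open>simp add: case_prod_beta\<close>)
  then show ?thesis
    by (simp add: amplify_apply_def Abs_ell2_inverse case_prod_beta)
qed

lemma norm_amplify_apply:
  fixes f :: "('a \<times> 'b) ell2"
  shows "norm (amplify_apply T f) \<le> norm T * norm f"
proof (rule ell2_norm_bound)
  fix F :: "('a \<times> 'b) set" assume "finite F"
  from amplify_bound[OF this, of T f]
  show "(\<Sum>z\<in>F. (cmod (ell2_coord (amplify_apply T f) z))\<^sup>2) \<le> (norm T * norm f)\<^sup>2"
    by (simp add: amplify_apply_coord case_prod_beta)
qed simp

definition amplify :: "'a ell2_op \<Rightarrow> ('a \<times> 'b) ell2_op"
  where "amplify T = mk_op (amplify_apply T)"

lemma op_apply_amplify: "op_apply (amplify T) f = amplify_apply T f"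
  unfolding amplify_def
proof (rule op_apply_mk_op)
  interpret T: bounded_linear "op_apply T" by (rule bounded_linear_op_apply)
  show "bounded_linear (amplify_apply T :: ('a \<times> 'b) ell2 \<Rightarrow> _)"
  proof (rule bounded_linear_intro[where K = "norm T"])
    show "norm (amplify_apply T x) \<le> norm x * norm T" for x :: "('a \<times> 'b) ell2"
      using norm_amplify_apply[of T x] by (simp add: mult.commute)
  qed (auto intro!: ell2_eqI simp: amplify_apply_coord ell2_slice_add ell2_slice_scaleR T.add T.scaleR)
  show "amplify_apply T (c *\<^sub>C x) = c *\<^sub>C amplify_apply T x" for c and x :: "('a \<times> 'b) ell2"
    by (auto intro!: ell2_eqI simp: amplify_apply_coord ell2_slice_scaleC op_apply_scaleC)
qed

text \<open>\<open>S \<otimes> T = (S \<otimes> 1)(1 \<otimes> T)\<close>, with \<open>1 \<otimes> T\<close> obtained from \<open>T \<otimes> 1\<close> by the flip;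
  see \<open>op_tensor_apply\<close> below.\<close>

definition op_tensor :: "'a ell2_op \<Rightarrow> 'b ell2_op \<Rightarrow> ('a \<times> 'b) ell2_op"  (infixr \<open>\<otimes>\<^sub>o\<close> 72)
  where "S \<otimes>\<^sub>o T = amplify S * op_reindex prod.swap (amplify T)"

definition ell2_tensor :: "'a ell2 \<Rightarrow> 'b ell2 \<Rightarrow> ('a \<times> 'b) ell2"
  where "ell2_tensor f g = Abs_ell2 (\<lambda>(x, y). ell2_coord f x * ell2_coord g y)"

lemma ell2_tensor_coord:
  fixes f :: "'a ell2" and g :: "'b ell2"
  shows "ell2_coord (ell2_tensor f g) (x, y) = ell2_coord f x * ell2_coord g y"
proof -
  have "(\<lambda>z. (cmod (case z of (x, y) \<Rightarrow> ell2_coord f x * ell2_coord g y))\<^sup>2) summable_on UNIV"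
  proof (rule square_summable_bound)
    fix F :: "('a \<times> 'b) set" assume F: "finite F"
    have "(\<Sum>z\<in>F. (cmod (case z of (x, y) \<Rightarrow> ell2_coord f x * ell2_coord g y))\<^sup>2)
       \<le> (\<Sum>(x, y)\<in>fst ` F \<times> snd ` F. (cmod (ell2_coord f x))\<^sup>2 * (cmod (ell2_coord g y))\<^sup>2)"
      using F unfolding case_prod_beta norm_mult power_mult_distrib
      by (intro sum_mono2) (auto simp: rev_image_eqI)
    also have "\<dots> = (\<Sum>x\<in>fst ` F. (cmod (ell2_coord f x))\<^sup>2) * (\<Sum>y\<in>snd ` F. (cmod (ell2_coord g y))\<^sup>2)"
      by (simp add: sum_product sum.cartesian_product)
    also have "\<dots> \<le> (norm f)\<^sup>2 * (norm g)\<^sup>2"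
      using F by (intro mult_mono ell2_sum_le_norm) (auto intro: sum_nonneg)
    finally show "(\<Sum>z\<in>F. (cmod (case z of (x, y) \<Rightarrow> ell2_coord f x * ell2_coord g y))\<^sup>2)
        \<le> (norm f)\<^sup>2 * (norm g)\<^sup>2" .
  qed
  then show ?thesis by (simp add: ell2_tensor_def Abs_ell2_inverse)
qed

lemma op_tensor_apply:
  fixes f :: "'a ell2" and g :: "'b ell2"
  shows "op_apply (S \<otimes>\<^sub>o T) (ell2_tensor f g) = ell2_tensor (op_apply S f) (op_apply T g)"
proof (rule ell2_eqI)
  fix z :: "'a \<times> 'b"
  have bij: "bij (prod.swap :: 'a \<times> 'b \<Rightarrow> 'b \<times> 'a)" by simp
  have inv: "inv (prod.swap :: 'a \<times> 'b \<Rightarrow> 'b \<times> 'a) = prod.swap"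
    by (rule inv_equality) simp_all
  have sl: "ell2_slice (ell2_reindex prod.swap (ell2_tensor f g)) x = ell2_coord f x *\<^sub>C g" for x
    by (rule ell2_eqI) (simp add: ell2_reindex_coord ell2_tensor_coord)
  have r: "op_apply (op_reindex prod.swap (amplify T)) (ell2_tensor f g) = ell2_tensor f (op_apply T g)"
    by (rule ell2_eqI)
       (auto simp: op_apply_reindex[OF bij] inv ell2_reindex_coord op_apply_amplify
         amplify_apply_coord sl op_apply_scaleC ell2_tensor_coord)
  have sl': "ell2_slice (ell2_tensor f h) y = ell2_coord h y *\<^sub>C f" for h :: "'b ell2" and y
    by (rule ell2_eqI) (simp add: ell2_tensor_coord)
  show "ell2_coord (op_apply (S \<otimes>\<^sub>o T) (ell2_tensor f g)) z
      = ell2_coord (ell2_tensor (op_apply S f) (op_apply T g)) z"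
    by (cases z) (simp add: op_tensor_def r op_apply_amplify amplify_apply_coord sl' op_apply_scaleC
        ell2_tensor_coord)
qed

lemma ket_tensor: "ell2_tensor (ket a) (ket b) = ket (a, b)"
  by (rule ell2_eqI) (auto simp: ell2_tensor_coord split_paired_all)

lemma op_tensor_ket_coord:
  "ell2_coord (op_apply (S \<otimes>\<^sub>o T) (ket (a, b))) (x, y)
     = ell2_coord (op_apply S (ket a)) x * ell2_coord (op_apply T (ket b)) y"
  by (simp add: ket_tensor[symmetric] op_tensor_apply ell2_tensor_coord)

section \<open>Free groups\<close>

definition flip_letter :: "'a \<times> bool \<Rightarrow> 'a \<times> bool"
  where "flip_letter s = (fst s, \<not> snd s)"

definition reduced_word :: "('a \<times> bool) list \<Rightarrow> bool"
  where "reduced_word = successively (\<lambda>s t. t \<noteq> flip_letter s)"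

text \<open>The letter \<open>(a, True)\<close> stands for the generator \<open>a\<close>, the letter \<open>(a, False)\<close> for its inverse.\<close>

typedef 'a free_group = "{w :: ('a \<times> bool) list. reduced_word w}"
  morphisms word_of Abs_free_group
  by (rule exI[of _ "[]"]) (simp add: reduced_word_def)

fun push_letter :: "'a \<times> bool \<Rightarrow> ('a \<times> bool) list \<Rightarrow> ('a \<times> bool) list" where
  "push_letter s [] = [s]"
| "push_letter s (t # w) = (if t = flip_letter s then w else s # t # w)"

abbreviation reduced_append :: "('a \<times> bool) list \<Rightarrow> ('a \<times> bool) list \<Rightarrow> ('a \<times> bool) list"
  where "reduced_append u v \<equiv> foldr push_letter u v"

lemma flip_flip [simp]: "flip_letter (flip_letter s) = s"
  by (simp add: flip_letter_def)

lemma reduced_push: "reduced_word w \<Longrightarrow> reduced_word (push_letter s w)"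
  by (cases w) (auto simp: reduced_word_def successively_Cons)

lemma reduced_reduced_append: "reduced_word v \<Longrightarrow> reduced_word (reduced_append u v)"
  by (induction u) (auto intro: reduced_push)

lemma push_flip: "reduced_word w \<Longrightarrow> push_letter s (push_letter (flip_letter s) w) = w"
  by (cases w rule: remdups_adj.cases) (auto simp: reduced_word_def successively_Cons)

lemma push_reduced: "reduced_word (s # w) \<Longrightarrow> push_letter s w = s # w"
  by (cases w) (auto simp: reduced_word_def)

lemma reduced_append_Nil: "reduced_word u \<Longrightarrow> reduced_append u [] = u"
  by (induction u) (auto simp: push_reduced, auto simp: reduced_word_def successively_Cons push_reduced)

lemma reduced_append_push:
  "reduced_word w \<Longrightarrow> reduced_append (push_letter s v) w = push_letter s (reduced_append v w)"
proof (cases v)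
  case (Cons t v')
  assume w: "reduced_word w"
  show ?thesis
    using push_flip[OF reduced_reduced_append[OF w], of s v'] Cons by auto
qed simp

lemma reduced_append_assoc:
  "reduced_word w \<Longrightarrow> reduced_append (reduced_append u v) w = reduced_append u (reduced_append v w)"
  by (induction u) (auto simp: reduced_append_push)

lemma reduced_append_inverse:
  "reduced_word w \<Longrightarrow> reduced_append (rev (map flip_letter u)) (reduced_append u w) = w"
proof (induction u arbitrary: w)
  case (Cons s u)
  have "push_letter (flip_letter s) (push_letter s (reduced_append u w)) = reduced_append u w"
    using push_flip[of "reduced_append u w" "flip_letter s"] reduced_reduced_append[OF Cons.prems] by simp
  then show ?case using Cons by simp
qed simp

lemma reduced_inverse: "reduced_word u \<Longrightarrow> reduced_word (rev (map flip_letter u))"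
  unfolding reduced_word_def successively_rev successively_map
  by (erule successively_mono) (metis flip_flip)

lemmas word_of_reduced [simp] = word_of[simplified]

text \<open>The library's class of not necessarily commutative groups is written additively.\<close>

instantiation free_group :: (type) group_add
begin

definition zero_free_group :: "'a free_group"
  where "0 = Abs_free_group []"
definition plus_free_group :: "'a free_group \<Rightarrow> 'a free_group \<Rightarrow> 'a free_group"
  where "g + h = Abs_free_group (reduced_append (word_of g) (word_of h))"
definition uminus_free_group :: "'a free_group \<Rightarrow> 'a free_group"
  where "- g = Abs_free_group (rev (map flip_letter (word_of g)))"
definition minus_free_group :: "'a free_group \<Rightarrow> 'a free_group \<Rightarrow> 'a free_group"
  where "g - h = g + - (h :: 'a free_group)"

lemma word_of_ops:
  "word_of (0 :: 'a free_group) = []"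
  "word_of (g + h) = reduced_append (word_of g) (word_of h)"
  "word_of (- g) = rev (map flip_letter (word_of g))" for g h :: "'a free_group"
  by (simp_all add: zero_free_group_def plus_free_group_def uminus_free_group_def
      Abs_free_group_inverse reduced_reduced_append reduced_inverse)
     (simp add: Abs_free_group_inverse reduced_word_def)

instance
proof
  fix g h k :: "'a free_group"
  show "g + h + k = g + (h + k)" "0 + g = g" "g + 0 = g" "- g + g = 0"
    using reduced_append_inverse[of "[]" "word_of g"]
    by (simp_all add: word_of_inject[symmetric] word_of_ops reduced_append_assoc reduced_append_Nil)
       (simp add: reduced_word_def)
  show "g + - h = g - h" by (simp add: minus_free_group_def)
qed

end

section \<open>Reduced group C*-algebras and their coproducts\<close>

definition complex_span :: "'a::complex_star_algebra set \<Rightarrow> 'a set"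
  where "complex_span S = {\<Sum>x\<in>F. c x *\<^sub>C x | F c. finite F \<and> F \<subseteq> S}"

text \<open>Unital *-homomorphisms between *-subalgebras. Between C*-algebras they are automatically
  contractive, so no continuity is required.\<close>

definition star_hom ::
    "'a::complex_star_algebra set \<Rightarrow> 'b::complex_star_algebra set \<Rightarrow> ('a \<Rightarrow> 'b) \<Rightarrow> bool"
  where "star_hom A B \<phi> \<longleftrightarrow>
    (\<forall>x\<in>A. \<phi> x \<in> B) \<and> \<phi> 1 = 1 \<and>
    (\<forall>x\<in>A. \<forall>y\<in>A. \<phi> (x + y) = \<phi> x + \<phi> y \<and> \<phi> (x * y) = \<phi> x * \<phi> y) \<and>
    (\<forall>c. \<forall>x\<in>A. \<phi> (c *\<^sub>C x) = c *\<^sub>C \<phi> x) \<and>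
    (\<forall>x\<in>A. \<phi> (star x) = star (\<phi> x))"

definition left_regular :: "'g::group_add \<Rightarrow> 'g ell2_op"
  where "left_regular g = mk_op (ell2_reindex (\<lambda>x. - g + x))"

lemma bij_left_translation: "bij (\<lambda>x. g + x)" for g :: "'g::group_add"
  by (rule o_bij[of "\<lambda>x. - g + x"]) (auto simp: fun_eq_iff add.assoc[symmetric])

lemma left_regular_ket: "op_apply (left_regular g) (ket h) = ket (g + h)"
proof -
  have "inj (\<lambda>x. - g + x)" by (rule bij_is_inj[OF bij_left_translation])
  then show ?thesis
    unfolding left_regular_def
    by (subst op_apply_mk_op)
       (auto intro!: ell2_eqI simp: bounded_linear_ell2_reindex ell2_reindex_scaleC ell2_reindex_coord
         eq_neg_iff_add_eq_0 add.assoc[symmetric] minus_add_cancel)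
qed

definition reduced_group_algebra :: "'g::group_add ell2_op set"
  where "reduced_group_algebra = closure (complex_span (range left_regular))"

text \<open>For concrete C*-algebras \<open>A \<subseteq> B(\<ell>\<^sup>2(X))\<close> and \<open>B \<subseteq> B(\<ell>\<^sup>2(Y))\<close> the minimal tensor product is
  the spatial one.\<close>

definition min_tensor :: "'a ell2_op set \<Rightarrow> 'b ell2_op set \<Rightarrow> ('a \<times> 'b) ell2_op set"  (infixr \<open>\<otimes>\<^sub>m\<close> 72)
  where "A \<otimes>\<^sub>m B = closure (complex_span {a \<otimes>\<^sub>o b | a b. a \<in> A \<and> b \<in> B})"

text \<open>The *-homomorphism determined by \<open>\<Delta>(g) = g \<otimes> g\<close>. It exists by \<open>group_comult\<close> below and is
  unique on the reduced group algebra; the choice only fixes irrelevant values outside it.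
  Continuity is automatic and recorded for convenience.\<close>

definition group_comult :: "'g::group_add ell2_op \<Rightarrow> ('g \<times> 'g) ell2_op"
  where "group_comult = (SOME \<Delta>.
    star_hom reduced_group_algebra (reduced_group_algebra \<otimes>\<^sub>m reduced_group_algebra) \<Delta> \<and>
    continuous_on reduced_group_algebra \<Delta> \<and>
    (\<forall>g. \<Delta> (left_regular g) = left_regular g \<otimes>\<^sub>o left_regular g))"

section \<open>The equivariant join\<close>

typedef unit_interval = "{0..1 :: real}"
  morphisms real_of_ui Abs_ui
  by (rule exI[of _ 0]) simp

instantiation unit_interval :: "{metric_space, zero, one}"
begin

definition zero_unit_interval :: unit_interval where "0 = Abs_ui 0"
definition one_unit_interval :: unit_interval where "1 = Abs_ui 1"
definition dist_unit_interval :: "unit_interval \<Rightarrow> unit_interval \<Rightarrow> real"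
  where "dist s t = dist (real_of_ui s) (real_of_ui t)"
definition uniformity_unit_interval :: "(unit_interval \<times> unit_interval) filter"
  where "uniformity_unit_interval = (INF e\<in>{0<..}. principal {(s, t). dist s t < e})"
definition open_unit_interval :: "unit_interval set \<Rightarrow> bool"
  where "open_unit_interval U \<longleftrightarrow> (\<forall>x\<in>U. \<forall>\<^sub>F (x', y) in uniformity. x' = x \<longrightarrow> y \<in> U)"

instance
proof
  fix r s t :: unit_interval
  show "dist s t = 0 \<longleftrightarrow> s = t"
    by (simp add: dist_unit_interval_def real_of_ui_inject)
  show "dist s t \<le> dist s r + dist t r"
    unfolding dist_unit_interval_def by (rule dist_triangle2)
qed (rule uniformity_unit_interval_def open_unit_interval_def)+

end

text \<open>\<open>C([0,1], B)\<close>, with the pointwise operations of the function type.\<close>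

definition path_algebra :: "'a ell2_op set \<Rightarrow> (unit_interval \<Rightarrow> 'a ell2_op) set"
  where "path_algebra B = {f. continuous_on UNIV f \<and> range f \<subseteq> B}"

definition equivariant_join ::
    "'a ell2_op set \<Rightarrow> 'h ell2_op set \<Rightarrow> ('a ell2_op \<Rightarrow> ('a \<times> 'h) ell2_op)
      \<Rightarrow> (unit_interval \<Rightarrow> ('a \<times> 'h) ell2_op) set"
  where "equivariant_join A H \<delta> =
    {f \<in> path_algebra (A \<otimes>\<^sub>m H).
       f 0 \<in> {(c *\<^sub>C 1) \<otimes>\<^sub>o h | c h. h \<in> H} \<and> f 1 \<in> \<delta> ` A}"

definition op_assoc :: "('a \<times> ('b \<times> 'c)) ell2_op \<Rightarrow> (('a \<times> 'b) \<times> 'c) ell2_op"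
  where "op_assoc = op_reindex (\<lambda>((x, y), z). (x, (y, z)))"

text \<open>\<open>id \<otimes> \<Delta> : A \<otimes> H \<rightarrow> A \<otimes> H \<otimes> H\<close>, the *-homomorphism determined by
  \<open>a \<otimes> h \<mapsto> a \<otimes> \<Delta>(h)\<close>; triple tensor products are bracketed to the left. Existence for
  \<open>\<Delta> = group_comult\<close> is \<open>id_tensor_comult\<close> below.\<close>

definition id_tensor_comult ::
    "'a ell2_op set \<Rightarrow> 'h ell2_op set \<Rightarrow> ('h ell2_op \<Rightarrow> ('h \<times> 'h) ell2_op)
      \<Rightarrow> ('a \<times> 'h) ell2_op \<Rightarrow> (('a \<times> 'h) \<times> 'h) ell2_op"
  where "id_tensor_comult A H \<Delta> = (SOME \<Psi>.
    star_hom (A \<otimes>\<^sub>m H) ((A \<otimes>\<^sub>m H) \<otimes>\<^sub>m H) \<Psi> \<and>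
    continuous_on (A \<otimes>\<^sub>m H) \<Psi> \<and>
    (\<forall>a\<in>A. \<forall>h\<in>H. \<Psi> (a \<otimes>\<^sub>o h) = op_assoc (a \<otimes>\<^sub>o \<Delta> h)))"

definition join_coaction ::
    "'a ell2_op set \<Rightarrow> 'h ell2_op set \<Rightarrow> ('h ell2_op \<Rightarrow> ('h \<times> 'h) ell2_op)
      \<Rightarrow> (unit_interval \<Rightarrow> ('a \<times> 'h) ell2_op) \<Rightarrow> unit_interval \<Rightarrow> (('a \<times> 'h) \<times> 'h) ell2_op"
  where "join_coaction A H \<Delta> f = id_tensor_comult A H \<Delta> \<circ> f"

text \<open>\<open>\<Phi> = F \<otimes> id\<close> for a *-homomorphism \<open>F\<close> from \<open>A\<close> to the join \<open>J\<close>. Here \<open>J \<otimes> H\<close> is regarded as a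
  subalgebra of \<open>C([0,1], A \<otimes> H) \<otimes> H = C([0,1], A \<otimes> H \<otimes> H)\<close>, with \<open>f \<otimes> h\<close> the path
  \<open>t \<mapsto> f(t) \<otimes> h\<close>. Minimal tensor products being functorial for *-homomorphisms, such a \<open>\<Phi>\<close> always
  exists, and it is unique on \<open>A \<otimes> H\<close>; hence the quantifier over \<open>\<Phi>\<close> in \<open>join_equivariant\<close>, which
  spells out \<open>\<delta>\<^sub>J \<circ> F = (F \<otimes> id) \<circ> \<delta>\<close>, merely names \<open>F \<otimes> id\<close>.\<close>

definition is_tensor_id ::
    "'a ell2_op set \<Rightarrow> 'h ell2_op set \<Rightarrow> ('a ell2_op \<Rightarrow> unit_interval \<Rightarrow> ('a \<times> 'h) ell2_op)
      \<Rightarrow> (('a \<times> 'h) ell2_op \<Rightarrow> unit_interval \<Rightarrow> (('a \<times> 'h) \<times> 'h) ell2_op) \<Rightarrow> bool"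
  where "is_tensor_id A H F \<Phi> \<longleftrightarrow>
    star_hom (A \<otimes>\<^sub>m H) (path_algebra ((A \<otimes>\<^sub>m H) \<otimes>\<^sub>m H)) \<Phi> \<and>
    (\<forall>a\<in>A. \<forall>h\<in>H. \<Phi> (a \<otimes>\<^sub>o h) = (\<lambda>t. F a t \<otimes>\<^sub>o h))"

definition join_equivariant ::
    "'a ell2_op set \<Rightarrow> 'h ell2_op set \<Rightarrow> ('h ell2_op \<Rightarrow> ('h \<times> 'h) ell2_op)
      \<Rightarrow> ('a ell2_op \<Rightarrow> ('a \<times> 'h) ell2_op)
      \<Rightarrow> ('a ell2_op \<Rightarrow> unit_interval \<Rightarrow> ('a \<times> 'h) ell2_op) \<Rightarrow> bool"
  where "join_equivariant A H \<Delta> \<delta> F \<longleftrightarrow>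
    (\<exists>\<Phi>. is_tensor_id A H F \<Phi> \<and> (\<forall>a\<in>A. join_coaction A H \<Delta> (F a) = \<Phi> (\<delta> a)))"

section \<open>Existence of the coproduct and of its amplification\<close>

lemma bounded_linear_scaleC_op: "bounded_linear (\<lambda>T :: 'a ell2_op. c *\<^sub>C T)"
proof (rule bounded_linear_intro[where K = "cmod c"])
  show "norm (c *\<^sub>C T) \<le> norm T * cmod c" for T :: "'a ell2_op"
  proof (rule norm_op_bound)
    fix x
    show "norm (op_apply (c *\<^sub>C T) x) \<le> norm T * cmod c * norm x"
      using mult_left_mono[OF norm_op_apply[of T x], of "cmod c"] by (simp add: ac_simps)
  qed simp
qed (auto intro!: op_eqI simp: scaleC_ell2_laws)

lemma star_op_eqI:
  assumes "\<And>a b. ell2_coord (op_apply T (ket a)) b = cnj (ell2_coord (op_apply S (ket b)) a)"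
  shows "S = star T"
proof (rule op_ext_ket, rule ell2_eqI)
  fix b a
  show "ell2_coord (op_apply S (ket b)) a = ell2_coord (op_apply (star T) (ket b)) a"
    by (simp add: star_ell2_op_def op_apply_adjoint adjoint_apply_coord assms)
qed

lemma star_op_coord:
  "ell2_coord (op_apply (star T) (ket b)) a = cnj (ell2_coord (op_apply T (ket a)) b)"
  by (simp add: star_ell2_op_def op_apply_adjoint adjoint_apply_coord)

definition star_embedding :: "('a ell2_op \<Rightarrow> 'b ell2_op) \<Rightarrow> bool"
  where "star_embedding \<phi> \<longleftrightarrow> bounded_linear \<phi> \<and> star_hom UNIV UNIV \<phi>"

lemma star_embedding_comp: "star_embedding \<phi> \<Longrightarrow> star_embedding \<psi> \<Longrightarrow> star_embedding (\<lambda>x. \<phi> (\<psi> x))"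
  unfolding star_embedding_def star_hom_def by (auto intro: bounded_linear_compose)

lemma star_embedding_reindex:
  assumes "bij \<pi>"
  shows "star_embedding (op_reindex \<pi>)"
proof -
  have i: "inj \<pi>" "inj (inv \<pi>)" using assms by (auto intro: bij_is_inj bij_imp_bij_inv)
  have c: "ell2_reindex (inv \<pi>) (ell2_reindex \<pi> f) = f" "ell2_reindex \<pi> (ell2_reindex (inv \<pi>) f') = f'" for f f'
    using assms i by (auto intro!: ell2_eqI simp: ell2_reindex_coord bij_is_surj surj_f_inv_f)
  interpret R: bounded_linear "ell2_reindex \<pi>" by (rule bounded_linear_ell2_reindex[OF i(1)])
  have "bounded_linear (op_reindex \<pi>)"
  proof (rule bounded_linear_intro[where K = 1])
    show "norm (op_reindex \<pi> T) \<le> norm T * 1" for T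
    proof (rule norm_op_bound)
      fix x
      have "norm (op_apply (op_reindex \<pi> T) x) \<le> norm (op_apply T (ell2_reindex (inv \<pi>) x))"
        unfolding op_apply_reindex[OF assms] by (rule norm_ell2_reindex[OF i(1)])
      also have "\<dots> \<le> norm T * norm (ell2_reindex (inv \<pi>) x)" by (rule norm_op_apply)
      also have "\<dots> \<le> norm T * norm x" by (intro mult_left_mono norm_ell2_reindex i) simp
      finally show "norm (op_apply (op_reindex \<pi> T) x) \<le> norm T * 1 * norm x" by simp
    qed simp
  qed (auto intro!: op_eqI simp: op_apply_reindex[OF assms] R.add R.scaleR)
  moreover have "op_reindex \<pi> (star T) = star (op_reindex \<pi> T)" for T
    by (rule star_op_eqI) (simp add: op_reindex_ket_coord[OF assms] star_op_coord)
  moreover have "op_reindex \<pi> (c *\<^sub>C T) = c *\<^sub>C op_reindex \<pi> T" "op_reindex \<pi> (S * T) = op_reindex \<pi> S * op_reindex \<pi> T"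
    "op_reindex \<pi> 1 = 1" "op_reindex \<pi> (S + T) = op_reindex \<pi> S + op_reindex \<pi> T" for c S T
    by (auto intro!: op_eqI simp: op_apply_reindex[OF assms] ell2_reindex_scaleC i c R.add)
  ultimately show ?thesis by (auto simp: star_embedding_def star_hom_def)
qed

lemma star_embedding_amplify: "star_embedding (amplify :: 'a ell2_op \<Rightarrow> ('a \<times> 'b) ell2_op)"
proof -
  have *: "op_apply (amplify T) f = amplify_apply T f" for T :: "'a ell2_op" and f :: "('a \<times> 'b) ell2"
    by (rule op_apply_amplify)
  have ket: "ell2_slice (ket (a, b) :: ('a \<times> 'b) ell2) y = (if y = b then ket a else 0)" for a b y
    by (rule ell2_eqI) auto
  have slice: "ell2_slice (amplify_apply T f) y = op_apply T (ell2_slice f y)" for T :: "'a ell2_op" and f :: "('a \<times> 'b) ell2" and y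
    by (rule ell2_eqI) (simp add: amplify_apply_coord)
  have z: "op_apply T 0 = 0" for T :: "'a ell2_op"
    by (rule linear_0[OF bounded_linear.linear[OF bounded_linear_op_apply]])
  have "bounded_linear (amplify :: 'a ell2_op \<Rightarrow> ('a \<times> 'b) ell2_op)"
  proof (rule bounded_linear_intro[where K = 1])
    show "norm (amplify T :: ('a \<times> 'b) ell2_op) \<le> norm T * 1" for T
      by (rule norm_op_bound) (auto simp: * norm_amplify_apply)
  qed (auto intro!: op_eqI ell2_eqI simp: * amplify_apply_coord)
  moreover have "amplify (star T) = star (amplify T :: ('a \<times> 'b) ell2_op)" for T
  proof (rule star_op_eqI)
    fix a b :: "'a \<times> 'b"
    show "ell2_coord (op_apply (amplify T) (ket a)) b = cnj (ell2_coord (op_apply (amplify (star T)) (ket b)) a)"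
      by (cases a; cases b) (simp add: * amplify_apply_coord ket star_op_coord z)
  qed
  moreover have "amplify (c *\<^sub>C T) = c *\<^sub>C (amplify T :: ('a \<times> 'b) ell2_op)"
    "amplify (S * T) = amplify S * (amplify T :: ('a \<times> 'b) ell2_op)"
    "amplify 1 = (1 :: ('a \<times> 'b) ell2_op)" "amplify (S + T) = amplify S + (amplify T :: ('a \<times> 'b) ell2_op)" for c S T
    by (auto intro!: op_eqI ell2_eqI simp: * amplify_apply_coord slice)
  ultimately show ?thesis by (auto simp: star_embedding_def star_hom_def)
qed

lemma bounded_linear_amplify: "bounded_linear amplify"
  and bounded_linear_op_reindex: "bij \<pi> \<Longrightarrow> bounded_linear (op_reindex \<pi>)"
  using star_embedding_amplify star_embedding_reindex unfolding star_embedding_def by blast+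

lemma star_embedding_scaleC: "star_embedding \<phi> \<Longrightarrow> \<phi> (c *\<^sub>C T) = c *\<^sub>C \<phi> T"
  by (simp add: star_embedding_def star_hom_def)

lemma bounded_linear_op_tensor_right: "bounded_linear (\<lambda>T. S \<otimes>\<^sub>o T)"
  unfolding op_tensor_def
  by (intro bounded_linear_compose[OF bounded_linear_mult_right]
      bounded_linear_compose[OF bounded_linear_op_reindex bounded_linear_amplify]) simp

lemma op_tensor_scaleC_right: "S \<otimes>\<^sub>o (c *\<^sub>C T) = c *\<^sub>C (S \<otimes>\<^sub>o T)"
  unfolding op_tensor_def
  by (simp add: star_embedding_scaleC[OF star_embedding_amplify] star_embedding_scaleC[OF star_embedding_reindex]
      mult_scaleC_right)

lemma complex_spanI: "finite F \<Longrightarrow> F \<subseteq> S \<Longrightarrow> (\<Sum>x\<in>F. c x *\<^sub>C x) \<in> complex_span S"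
  unfolding complex_span_def by (rule CollectI, rule exI[of _ F], rule exI[of _ c]) simp

lemma complex_span_base: "S \<subseteq> complex_span S"
proof
  fix x assume "x \<in> S"
  then show "x \<in> complex_span S"
    using complex_spanI[of "{x}" S "\<lambda>_. 1"] by (simp add: scaleC_one)
qed

lemma scaleC_zero: "(0 :: complex) *\<^sub>C (x :: 'a::complex_star_algebra) = 0"
  using scaleC_add_left[of 0 0 x] by simp

lemma scaleC_sum: "c *\<^sub>C (\<Sum>x\<in>F. f x :: 'a::complex_star_algebra) = (\<Sum>x\<in>F. c *\<^sub>C f x)"
proof (induction F rule: infinite_finite_induct)
  case (insert x F) then show ?case by (simp add: scaleC_add_right)
qed (use scaleC_add_right[of c "0 :: 'a" 0] in simp_all)

lemma complex_span_add:
  assumes "x \<in> complex_span S" "y \<in> complex_span S"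
  shows "x + y \<in> complex_span S"
proof -
  obtain F c where F: "finite F" "F \<subseteq> S" "x = (\<Sum>x\<in>F. c x *\<^sub>C x)"
    using assms(1) unfolding complex_span_def by blast
  obtain G d where G: "finite G" "G \<subseteq> S" "y = (\<Sum>x\<in>G. d x *\<^sub>C x)"
    using assms(2) unfolding complex_span_def by blast
  have "x = (\<Sum>x\<in>F \<union> G. (if x \<in> F then c x else 0) *\<^sub>C x)"
    unfolding F(3) using F G by (intro sum.mono_neutral_cong_left) (auto simp: scaleC_zero)
  moreover have "y = (\<Sum>x\<in>F \<union> G. (if x \<in> G then d x else 0) *\<^sub>C x)"
    unfolding G(3) using F G by (intro sum.mono_neutral_cong_left) (auto simp: scaleC_zero)
  ultimately have "x + y = (\<Sum>x\<in>F \<union> G. ((if x \<in> F then c x else 0) + (if x \<in> G then d x else 0)) *\<^sub>C x)"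
    by (simp only: sum.distrib scaleC_add_left)
  then show ?thesis using complex_spanI[of "F \<union> G" S] F G by simp
qed

lemma complex_span_scaleC:
  assumes "x \<in> complex_span S"
  shows "c *\<^sub>C x \<in> complex_span S"
proof -
  obtain F d where F: "finite F" "F \<subseteq> S" "x = (\<Sum>x\<in>F. d x *\<^sub>C x)"
    using assms unfolding complex_span_def by blast
  have "c *\<^sub>C x = (\<Sum>x\<in>F. (c * d x) *\<^sub>C x)" by (simp add: F(3) scaleC_sum scaleC_scaleC)
  then show ?thesis using complex_spanI[of F S] F by simp
qed

lemma complex_span_induct [consumes 1, case_names base step]:
  assumes "x \<in> complex_span S" and "P 0"
    and "\<And>c x y. x \<in> S \<Longrightarrow> y \<in> complex_span S \<Longrightarrow> P y \<Longrightarrow> P (c *\<^sub>C x + y)"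
  shows "P x"
proof -
  obtain F c where F: "finite F" "F \<subseteq> S" "x = (\<Sum>x\<in>F. c x *\<^sub>C x)"
    using assms(1) unfolding complex_span_def by blast
  from F(1,2) have "P (\<Sum>x\<in>F. c x *\<^sub>C x)"
  proof (induction F rule: finite_induct)
    case (insert a F)
    then have "(\<Sum>x\<in>F. c x *\<^sub>C x) \<in> complex_span S" by (intro complex_spanI) auto
    then show ?case using insert by (simp add: assms(3))
  qed (simp add: assms(2))
  then show ?thesis using F(3) by simp
qed

lemma closure_complex_span_add:
  fixes S :: "'a ell2_op set"
  assumes "x \<in> closure (complex_span S)" "y \<in> closure (complex_span S)"
  shows "x + y \<in> closure (complex_span S)"
proof -
  obtain u where u: "\<And>n. u n \<in> complex_span S" "u \<longlonglongrightarrow> x" using assms(1) closure_sequential by blast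
  obtain v where v: "\<And>n. v n \<in> complex_span S" "v \<longlonglongrightarrow> y" using assms(2) closure_sequential by blast
  show ?thesis
    unfolding closure_sequential
    by (intro exI[of _ "\<lambda>n. u n + v n"] conjI allI complex_span_add tendsto_add u v)
qed

lemma closure_complex_span_scaleC:
  fixes S :: "'a ell2_op set"
  assumes "x \<in> closure (complex_span S)"
  shows "c *\<^sub>C x \<in> closure (complex_span S)"
proof -
  obtain u where u: "\<And>n. u n \<in> complex_span S" "u \<longlonglongrightarrow> x" using assms(1) closure_sequential by blast
  show ?thesis
    unfolding closure_sequential
    by (intro exI[of _ "\<lambda>n. c *\<^sub>C u n"] conjI allI complex_span_scaleC u
        bounded_linear.tendsto[OF bounded_linear_scaleC_op])
qed

lemma closure_complex_span_zero: "0 \<in> closure (complex_span S)"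
proof -
  have "0 \<in> complex_span S" using complex_spanI[of "{}" S] by simp
  then show ?thesis using closure_subset by blast
qed

lemma closure_complex_span_image:
  fixes \<phi> :: "'a ell2_op \<Rightarrow> 'b ell2_op"
  assumes \<phi>: "bounded_linear \<phi>" "\<And>c T. \<phi> (c *\<^sub>C T) = c *\<^sub>C \<phi> T"
    and S: "\<And>x. x \<in> S \<Longrightarrow> \<phi> x \<in> closure (complex_span S')"
    and x: "x \<in> closure (complex_span S)"
  shows "\<phi> x \<in> closure (complex_span S')"
proof -
  interpret bounded_linear \<phi> by (rule \<phi>(1))
  have "\<phi> y \<in> closure (complex_span S')" if "y \<in> complex_span S" for y
    using that
  proof (induction rule: complex_span_induct)
    case base
    show ?case by (simp only: zero closure_complex_span_zero)
  next
    case (step c x y)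
    show ?case
      unfolding add \<phi>(2)
      by (rule closure_complex_span_add[OF closure_complex_span_scaleC[OF S[OF step(1)]] step(3)])
  qed
  then have "\<phi> ` closure (complex_span S) \<subseteq> closure (complex_span S')"
    by (intro image_closure_subset linear_continuous_on \<phi>) auto
  then show ?thesis using x by blast
qed

lemma closure_complex_span_base: "x \<in> S \<Longrightarrow> x \<in> closure (complex_span S)"
  by (rule subsetD[OF order_trans[OF complex_span_base closure_subset]])

lemma left_regular_in: "left_regular g \<in> reduced_group_algebra"
  unfolding reduced_group_algebra_def by (rule closure_complex_span_base) simp

lemma op_tensor_in_min_tensor: "a \<in> A \<Longrightarrow> b \<in> B \<Longrightarrow> a \<otimes>\<^sub>o b \<in> A \<otimes>\<^sub>m B"
  unfolding min_tensor_def by (rule closure_complex_span_base) blast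

lemma bij_shear: "bij (\<lambda>(z, y). (z, - p z + y))" for p :: "'a \<Rightarrow> 'g::group_add"
  by (rule o_bij[of "\<lambda>(z, y). (z, p z + y)"]) (auto simp: fun_eq_iff add.assoc[symmetric])

text \<open>\<open>T \<mapsto> W\<^sup>*(T \<otimes> 1)W\<close> from \<open>B(\<ell>\<^sup>2(X))\<close> to \<open>B(\<ell>\<^sup>2(X \<times> G))\<close>, with \<open>W\<close> the shear unitary.\<close>

definition shear :: "('a \<Rightarrow> 'g::group_add) \<Rightarrow> 'a ell2_op \<Rightarrow> ('a \<times> 'g) ell2_op"
  where "shear p T = op_reindex (\<lambda>(z, y). (z, - p z + y)) (amplify T)"

lemma star_embedding_shear: "star_embedding (shear p)"
  unfolding shear_def
  by (rule star_embedding_comp[OF star_embedding_reindex star_embedding_amplify]) (rule bij_shear)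

lemma shear_ket_coord:
  "ell2_coord (op_apply (shear p T) (ket (a, y))) (b, z)
     = (if - p a + y = - p b + z then ell2_coord (op_apply T (ket a)) b else 0)"
proof -
  have ket: "ell2_slice (ket (a, c)) d = (if d = c then ket a else 0)" for c d :: 'b
    by (rule ell2_eqI) auto
  have z: "op_apply T 0 = 0"
    by (rule linear_0[OF bounded_linear.linear[OF bounded_linear_op_apply]])
  show ?thesis
    unfolding shear_def op_reindex_ket_coord[OF bij_shear]
    by (auto simp: op_apply_amplify amplify_apply_coord ket z)
qed

lemma left_regular_coord: "ell2_coord (op_apply (left_regular g) (ket h)) k = (if k = g + h then 1 else 0)"
  by (simp add: left_regular_ket)

lemma cancel_shear: "(- x + y = - (g + x) + z) = (z = g + y)" for g x y z :: "'g::group_add"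
proof -
  have "- (g + x) + z = - x + (- g + z)"
    by (simp only: minus_add add.assoc)
  then have "(- x + y = - (g + x) + z) = (y = - g + z)" by (simp only: add_left_cancel)
  also have "\<dots> = (z = g + y)" by (auto simp: add.assoc[symmetric])
  finally show ?thesis .
qed

lemma shear_left_regular: "shear (\<lambda>x. x) (left_regular g) = left_regular g \<otimes>\<^sub>o left_regular g"
  by (rule op_ext_ket, rule ell2_eqI)
     (auto simp: shear_ket_coord op_tensor_ket_coord left_regular_coord cancel_shear split_paired_all)

lemma shear_tensor_left_regular:
  "shear snd (a \<otimes>\<^sub>o left_regular g) = (a \<otimes>\<^sub>o left_regular g) \<otimes>\<^sub>o left_regular g"
  by (rule op_ext_ket, rule ell2_eqI)
     (auto simp: shear_ket_coord op_tensor_ket_coord left_regular_coord cancel_shear split_paired_all)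

lemma bij_assoc: "bij (\<lambda>((x, y), z). (x, (y, z)))"
  by (rule o_bij[of "\<lambda>(x, (y, z)). ((x, y), z)"]) (auto simp: fun_eq_iff)

lemma op_assoc_tensor: "op_assoc (a \<otimes>\<^sub>o b \<otimes>\<^sub>o c) = (a \<otimes>\<^sub>o b) \<otimes>\<^sub>o c"
  unfolding op_assoc_def
  by (rule op_ext_ket, rule ell2_eqI)
     (auto simp: op_reindex_ket_coord[OF bij_assoc] op_tensor_ket_coord split_paired_all)

lemma star_embedding_star_hom:
  "star_embedding \<phi> \<Longrightarrow> (\<And>x. x \<in> A \<Longrightarrow> \<phi> x \<in> B) \<Longrightarrow> star_hom A B \<phi>"
  by (auto simp: star_embedding_def star_hom_def)

lemma group_comult:
  shows group_comult_star_hom: "star_hom (reduced_group_algebra :: 'g::group_add ell2_op set)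
      (reduced_group_algebra \<otimes>\<^sub>m reduced_group_algebra) group_comult" (is "?A group_comult")
    and group_comult_continuous: "continuous_on (reduced_group_algebra :: 'g ell2_op set) group_comult"
      (is "?B group_comult")
    and group_comult_left_regular:
      "group_comult (left_regular (g :: 'g)) = left_regular g \<otimes>\<^sub>o left_regular g"
proof -
  have bl: "bounded_linear (shear (\<lambda>x :: 'g. x))"
    using star_embedding_shear unfolding star_embedding_def by blast
  have "shear (\<lambda>x. x) x \<in> reduced_group_algebra \<otimes>\<^sub>m reduced_group_algebra"
    if "x \<in> reduced_group_algebra" for x :: "'g ell2_op"
    unfolding min_tensor_def
    using that[unfolded reduced_group_algebra_def]
  proof (rule closure_complex_span_image[OF bl star_embedding_scaleC[OF star_embedding_shear], rotated])
    fix x :: "'g ell2_op" assume "x \<in> range left_regular"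
    then show "shear (\<lambda>x. x) x \<in> closure (complex_span
        {a \<otimes>\<^sub>o b |a b. a \<in> reduced_group_algebra \<and> b \<in> reduced_group_algebra})"
      using op_tensor_in_min_tensor[OF left_regular_in left_regular_in]
      by (auto simp: shear_left_regular min_tensor_def)
  qed
  then have "?A (shear (\<lambda>x. x)) \<and> ?B (shear (\<lambda>x. x)) \<and>
      (\<forall>g :: 'g. shear (\<lambda>x. x) (left_regular g) = left_regular g \<otimes>\<^sub>o left_regular g)"
    by (auto intro!: star_embedding_star_hom star_embedding_shear linear_continuous_on bl shear_left_regular)
  then have "\<exists>\<Delta>. ?A \<Delta> \<and> ?B \<Delta> \<and> (\<forall>g :: 'g. \<Delta> (left_regular g) = left_regular g \<otimes>\<^sub>o left_regular g)"
    by (rule exI[of _ "shear (\<lambda>x. x)"])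
  from someI_ex[OF this, folded group_comult_def]
  show "?A group_comult" "?B group_comult"
    "group_comult (left_regular (g :: 'g)) = left_regular g \<otimes>\<^sub>o left_regular g" by blast+
qed

lemma shear_tensor:
  fixes a :: "'a ell2_op" and h :: "'g::group_add ell2_op"
  assumes h: "h \<in> reduced_group_algebra"
  shows "shear snd (a \<otimes>\<^sub>o h) = op_assoc (a \<otimes>\<^sub>o group_comult h)"
proof -
  let ?L = "\<lambda>h :: 'g ell2_op. shear snd (a \<otimes>\<^sub>o h)" and ?R = "\<lambda>h. op_assoc (a \<otimes>\<^sub>o h)"
  have bl: "bounded_linear ?L" 
    using bounded_linear_compose[OF _ bounded_linear_op_tensor_right] star_embedding_shear
    unfolding star_embedding_def by blast
  have br: "bounded_linear ?R"
    unfolding op_assoc_def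
    by (rule bounded_linear_compose[OF bounded_linear_op_reindex[OF bij_assoc] bounded_linear_op_tensor_right])
  interpret L: bounded_linear ?L by (rule bl)
  interpret R: bounded_linear ?R by (rule br)
  have Lc: "?L (c *\<^sub>C h) = c *\<^sub>C ?L h" for c h
    by (simp add: op_tensor_scaleC_right star_embedding_scaleC[OF star_embedding_shear])
  have Rc: "?R (c *\<^sub>C h) = c *\<^sub>C ?R h" for c h
    by (simp add: op_tensor_scaleC_right op_assoc_def star_embedding_scaleC[OF star_embedding_reindex[OF bij_assoc]])
  have sub: "complex_span (range left_regular) \<subseteq> reduced_group_algebra"
    unfolding reduced_group_algebra_def by (rule closure_subset)
  have zero: "group_comult (0 :: 'g ell2_op) = 0"
    using group_comult_star_hom closure_complex_span_zero
    unfolding star_hom_def reduced_group_algebra_def by (metis add_cancel_right_right)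
  have eq: "?L h - ?R (group_comult h) = 0" if "h \<in> complex_span (range left_regular)" for h :: "'g ell2_op"
    using that
  proof (induction rule: complex_span_induct)
    case (step c x y)
    then obtain g where x: "x = left_regular g" by blast
    have cx: "c *\<^sub>C x \<in> reduced_group_algebra"
      using step complex_span_scaleC complex_span_base sub by blast
    have "group_comult (c *\<^sub>C x + y) = c *\<^sub>C group_comult x + group_comult y"
      using group_comult_star_hom cx step sub x left_regular_in unfolding star_hom_def by (metis subsetD)
    then show ?case
      using step by (simp add: L.add R.add Lc Rc x shear_tensor_left_regular group_comult_left_regular op_assoc_tensor)
  qed (simp add: zero L.zero R.zero)
  have "continuous_on reduced_group_algebra (\<lambda>h :: 'g ell2_op. ?R (group_comult h))"
    by (rule continuous_on_compose2[OF linear_continuous_on[OF br, of UNIV] group_comult_continuous]) simp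
  then have cont: "continuous_on (closure (complex_span (range left_regular :: 'g ell2_op set))) (\<lambda>h. ?L h - ?R (group_comult h))"
    unfolding reduced_group_algebra_def[symmetric]
    by (rule continuous_on_diff[OF linear_continuous_on[OF bl]])
  have "?L h - ?R (group_comult h) = 0"
    using continuous_constant_on_closure[OF cont eq] h unfolding reduced_group_algebra_def by blast
  then show ?thesis by simp
qed

lemma id_tensor_comult:
  fixes A :: "'a ell2_op set"
  defines "H \<equiv> reduced_group_algebra :: 'g::group_add ell2_op set"
  shows "star_hom (A \<otimes>\<^sub>m H) ((A \<otimes>\<^sub>m H) \<otimes>\<^sub>m H) (id_tensor_comult A H group_comult)" (is "?A (id_tensor_comult A H group_comult)")
    and "continuous_on (A \<otimes>\<^sub>m H) (id_tensor_comult A H group_comult)" (is "?C (id_tensor_comult A H group_comult)")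
    and "a \<in> A \<Longrightarrow> h \<in> H \<Longrightarrow>
      id_tensor_comult A H group_comult (a \<otimes>\<^sub>o h) = op_assoc (a \<otimes>\<^sub>o group_comult h)"
proof -
  have bl: "bounded_linear (shear (snd :: 'a \<times> 'g \<Rightarrow> _))"
    using star_embedding_shear unfolding star_embedding_def by blast
  have gen: "shear snd (a \<otimes>\<^sub>o h) \<in> (A \<otimes>\<^sub>m H) \<otimes>\<^sub>m H" if "a \<in> A" "h \<in> H" for a h
    unfolding min_tensor_def[of "A \<otimes>\<^sub>m H"]
  proof (rule closure_complex_span_image[of "\<lambda>h. shear snd (a \<otimes>\<^sub>o h)"])
    show "bounded_linear (\<lambda>h :: 'g ell2_op. shear snd (a \<otimes>\<^sub>o h))"
      by (rule bounded_linear_compose[OF bl bounded_linear_op_tensor_right])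
    show "shear snd (a \<otimes>\<^sub>o (c *\<^sub>C T)) = c *\<^sub>C shear snd (a \<otimes>\<^sub>o T)" for c and T :: "'g ell2_op"
      by (simp add: op_tensor_scaleC_right star_embedding_scaleC[OF star_embedding_shear])
    show "h \<in> closure (complex_span (range left_regular))"
      using that unfolding H_def reduced_group_algebra_def by simp
    fix x :: "'g ell2_op" assume "x \<in> range left_regular"
    then obtain g where "x = left_regular g" by blast
    then show "shear snd (a \<otimes>\<^sub>o x) \<in> closure (complex_span {a \<otimes>\<^sub>o b |a b. a \<in> A \<otimes>\<^sub>m H \<and> b \<in> H})"
      using op_tensor_in_min_tensor[OF op_tensor_in_min_tensor[OF that(1) left_regular_in] left_regular_in, of g g]
      by (simp add: shear_tensor_left_regular min_tensor_def H_def)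
  qed
  have "shear snd x \<in> (A \<otimes>\<^sub>m H) \<otimes>\<^sub>m H" if "x \<in> A \<otimes>\<^sub>m H" for x
    unfolding min_tensor_def[of "A \<otimes>\<^sub>m H"] using that[unfolded min_tensor_def]
  proof (rule closure_complex_span_image[OF bl star_embedding_scaleC[OF star_embedding_shear], rotated])
    fix x assume "x \<in> {a \<otimes>\<^sub>o b |a b. a \<in> A \<and> b \<in> H}"
    then show "shear snd x \<in> closure (complex_span {a \<otimes>\<^sub>o b |a b. a \<in> A \<otimes>\<^sub>m H \<and> b \<in> H})"
      using gen unfolding min_tensor_def[of "A \<otimes>\<^sub>m H"] by blast
  qed
  then have "?A (shear snd) \<and> ?C (shear snd) \<and> (\<forall>a\<in>A. \<forall>h\<in>H. shear snd (a \<otimes>\<^sub>o h) = op_assoc (a \<otimes>\<^sub>o group_comult h))"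
    by (auto intro!: star_embedding_star_hom star_embedding_shear shear_tensor linear_continuous_on bl simp: H_def)
  then have "\<exists>\<Psi>. ?A \<Psi> \<and> ?C \<Psi> \<and> (\<forall>a\<in>A. \<forall>h\<in>H. \<Psi> (a \<otimes>\<^sub>o h) = op_assoc (a \<otimes>\<^sub>o group_comult h))"
    by (rule exI[of _ "shear snd"])
  from someI_ex[OF this, folded id_tensor_comult_def]
  show "?A (id_tensor_comult A H group_comult)" "?C (id_tensor_comult A H group_comult)"
    "a \<in> A \<Longrightarrow> h \<in> H \<Longrightarrow>
      id_tensor_comult A H group_comult (a \<otimes>\<^sub>o h) = op_assoc (a \<otimes>\<^sub>o group_comult h)" by blast+
qed

end

theory Submission
  imports Defs
begin

text \<open>For a group element \<open>g\<close>, equivariance forces \<open>F(g)(t) = a\<^sub>t \<otimes> g\<close> with a norm continuous path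
  of unitaries \<open>a\<^sub>t\<close> in the reduced group algebra; the boundary conditions of the join make \<open>a\<^sub>0\<close> a
  scalar and \<open>a\<^sub>1\<close> a scalar multiple of \<open>g\<close>. For a generator \<open>g\<close> no such path exists: the set \<open>S\<close> of
  reduced words that end in \<open>g\<close> satisfies \<open>hS \<Delta> S\<close> finite for all \<open>h\<close>, so the projection \<open>P\<close> onto
  \<open>\<ell>\<^sup>2(S)\<close> commutes with the reduced group algebra up to compact operators, and the Fredholm index of
  \<open>P a\<^sub>t P\<close> on \<open>\<ell>\<^sup>2(S)\<close> is constant along the path. It is \<open>0\<close> at a scalar, but \<open>-1\<close> at \<open>g\<close>, because
  \<open>gS = S - {g}\<close>.\<close>

section \<open>Completeness\<close>

text \<open>Completeness is what makes small perturbations of invertible operators invertible. Each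
  coordinate is bounded by the norm, so the limit can be built coordinatewise.\<close>

instance ell2 :: (type) banach
proof
  fix X :: "nat \<Rightarrow> 'a ell2" assume X: "Cauchy X"
  have "Cauchy (\<lambda>n. ell2_coord (X n) x)" for x
  proof (rule metric_CauchyI)
    fix e :: real assume "e > 0"
    then obtain N where N: "\<And>m n. m \<ge> N \<Longrightarrow> n \<ge> N \<Longrightarrow> dist (X m) (X n) < e"
      using X metric_CauchyD by blast
    have "dist (ell2_coord (X m) x) (ell2_coord (X n) x) < e" if "m \<ge> N" "n \<ge> N" for m n
      using ell2_coord_le_norm[of "X m - X n" x] N[OF that] by (simp add: dist_norm)
    then show "\<exists>N. \<forall>m\<ge>N. \<forall>n\<ge>N. dist (ell2_coord (X m) x) (ell2_coord (X n) x) < e" by blast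
  qed
  then have "\<exists>l. (\<lambda>n. ell2_coord (X n) x) \<longlonglongrightarrow> l" for x
    by (simp add: Cauchy_convergent_iff convergent_def)
  then obtain l where l: "\<And>x. (\<lambda>n. ell2_coord (X n) x) \<longlonglongrightarrow> l x" by metis
  \<comment> \<open>The Cauchy estimate on a finite set survives the limit in \<open>m\<close>, and
    \<open>N\<close> does not depend on that set.\<close>
  have tail: "\<exists>N. \<forall>n\<ge>N. \<forall>F. finite F \<longrightarrow> (\<Sum>x\<in>F. (cmod (ell2_coord (X n) x - l x))\<^sup>2) \<le> e\<^sup>2"
    if "e > 0" for e
  proof -
    obtain N where N: "\<And>m n. m \<ge> N \<Longrightarrow> n \<ge> N \<Longrightarrow> dist (X m) (X n) < e"
      using X \<open>e > 0\<close> metric_CauchyD by blast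
    have "(\<Sum>x\<in>F. (cmod (ell2_coord (X n) x - l x))\<^sup>2) \<le> e\<^sup>2" if "n \<ge> N" "finite F" for n F
    proof (rule tendsto_upperbound[OF _ _ sequentially_bot])
      show "(\<lambda>m. \<Sum>x\<in>F. (cmod (ell2_coord (X n) x - ell2_coord (X m) x))\<^sup>2)
          \<longlonglongrightarrow> (\<Sum>x\<in>F. (cmod (ell2_coord (X n) x - l x))\<^sup>2)"
        by (intro tendsto_intros l)
      show "\<forall>\<^sub>F m in sequentially. (\<Sum>x\<in>F. (cmod (ell2_coord (X n) x - ell2_coord (X m) x))\<^sup>2) \<le> e\<^sup>2"
      proof (rule eventually_sequentiallyI)
        fix m assume "N \<le> m"
        then have "norm (X n - X m) \<le> e" using N[of n m] \<open>n \<ge> N\<close> by (simp add: dist_norm)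
        then have "(norm (X n - X m))\<^sup>2 \<le> e\<^sup>2" by (intro power_mono) auto
        then show "(\<Sum>x\<in>F. (cmod (ell2_coord (X n) x - ell2_coord (X m) x))\<^sup>2) \<le> e\<^sup>2"
          using ell2_sum_le_norm[OF \<open>finite F\<close>, of "X n - X m"] by simp
      qed
    qed
    then show ?thesis by blast
  qed
  obtain N where N: "\<And>F. finite F \<Longrightarrow> (\<Sum>x\<in>F. (cmod (ell2_coord (X N) x - l x))\<^sup>2) \<le> 1\<^sup>2"
    using tail[of 1] by auto
  have "(\<lambda>x. (cmod (ell2_coord (X N) x - l x))\<^sup>2) summable_on UNIV"
    using N by (rule square_summable_bound)
  \<comment> \<open>The limit is written as \<open>X N\<close> minus a square-summable
    difference.\<close>
  then have "(\<lambda>x. (cmod (ell2_coord (X N) x + (-1) * (ell2_coord (X N) x - l x)))\<^sup>2) summable_on UNIV"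
    by (intro square_summable_plus square_summable_cmult ell2_summable)
  then have L: "ell2_coord (Abs_ell2 l) = l" by (simp add: Abs_ell2_inverse)
  have "X \<longlonglongrightarrow> Abs_ell2 l"
  proof (rule metric_LIMSEQ_I)
    fix e :: real assume "e > 0"
    then obtain M where M: "\<And>n F. n \<ge> M \<Longrightarrow> finite F \<Longrightarrow>
        (\<Sum>x\<in>F. (cmod (ell2_coord (X n) x - l x))\<^sup>2) \<le> (e/2)\<^sup>2"
      using tail[of "e/2"] by auto
    have "dist (X n) (Abs_ell2 l) < e" if "n \<ge> M" for n
    proof -
      have "norm (X n - Abs_ell2 l) \<le> e/2"
        by (rule ell2_norm_bound) (use M[OF that] \<open>e > 0\<close> in \<open>auto simp: L\<close>)
      then show ?thesis using \<open>e > 0\<close> by (simp add: dist_norm)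
    qed
    then show "\<exists>M. \<forall>n\<ge>M. dist (X n) (Abs_ell2 l) < e" by blast
  qed
  then show "convergent X" unfolding convergent_def by blast
qed

text \<open>Complex linearity passes to pointwise limits, so these operators are closed in the
  complete space of bounded real-linear maps.\<close>

instance ell2_op :: (type) banach
proof
  fix X :: "nat \<Rightarrow> 'a ell2_op" assume X: "Cauchy X"
  have d: "dist (blinfun_of_op S) (blinfun_of_op T) = dist S T" for S T :: "'a ell2_op"
    by (simp add: dist_norm norm_ell2_op.rep_eq minus_ell2_op.rep_eq)
  have "Cauchy (\<lambda>n. blinfun_of_op (X n))"
    using X unfolding Cauchy_def d .
  then obtain L where L: "(\<lambda>n. blinfun_of_op (X n)) \<longlonglongrightarrow> L"
    by (auto simp: Cauchy_convergent_iff convergent_def)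
  have pt: "(\<lambda>n. blinfun_of_op (X n) x) \<longlonglongrightarrow> L x" for x
    by (intro tendsto_intros L)
  have "L (c *\<^sub>C x) = c *\<^sub>C L x" for c x
  proof (rule LIMSEQ_unique[OF pt])
    have "(\<lambda>n. c *\<^sub>C blinfun_of_op (X n) x) \<longlonglongrightarrow> c *\<^sub>C L x"
      by (rule bounded_linear.tendsto[OF bounded_linear_scaleC_ell2 pt])
    then show "(\<lambda>n. blinfun_of_op (X n) (c *\<^sub>C x)) \<longlonglongrightarrow> c *\<^sub>C L x"
      by (simp add: op_apply.rep_eq[symmetric] op_apply_scaleC)
  qed
  then have "blinfun_of_op (Abs_ell2_op L) = L" by (simp add: Abs_ell2_op_inverse)
  then have "(\<lambda>n. blinfun_of_op (X n)) \<longlonglongrightarrow> blinfun_of_op (Abs_ell2_op L)" using L by (simp only:)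
  then have "X \<longlonglongrightarrow> Abs_ell2_op L"
    unfolding tendsto_dist_iff[of _ "blinfun_of_op _"] tendsto_dist_iff[of X] d .
  then show "convergent X" unfolding convergent_def by blast
qed

section \<open>Finite-rank perturbations of invertible elements\<close>

definition invertible_elt :: "'a::ring_1 \<Rightarrow> bool"
  where "invertible_elt r \<longleftrightarrow> (\<exists>s. r * s = 1 \<and> s * r = 1)"

lemma invertible_elt_mult:
  assumes "invertible_elt (r :: 'a::ring_1)" "invertible_elt s"
  shows "invertible_elt (r * s)"
proof -
  obtain r' s' where "r * r' = 1" "r' * r = 1" "s * s' = 1" "s' * s = 1"
    using assms unfolding invertible_elt_def by blast
  then have "(r * s) * (s' * r') = 1" "(s' * r') * (r * s) = 1"
    by (metis mult.assoc mult.right_neutral)+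
  then show ?thesis unfolding invertible_elt_def by blast
qed

text \<open>The contractions taking x to 1 - e x and to 1 - x e have fixed points, which are a right
  and a left inverse; associativity makes them equal.\<close>

lemma invertible_elt_one_plus:
  fixes e :: "'a::{real_normed_algebra_1, banach}"
  assumes "norm e < 1"
  shows "invertible_elt (1 + e)"
proof -
  have "\<exists>!x. 1 - e * x = x"
  proof (rule banach_fix_type[of "norm e"])
    show "\<forall>x y. dist (1 - e * x) (1 - e * y) \<le> norm e * dist x y"
    proof (intro allI)
      fix x y
      have "1 - e * x - (1 - e * y) = e * (y - x)" by (simp add: algebra_simps)
      then show "dist (1 - e * x) (1 - e * y) \<le> norm e * dist x y"
        using norm_mult_ineq[of e "y - x"] by (simp only: dist_norm norm_minus_commute[of x])
    qed
  qed (use assms in auto)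
  then obtain x where x: "1 - e * x = x" by blast
  have "\<exists>!x. 1 - x * e = x"
  proof (rule banach_fix_type[of "norm e"])
    show "\<forall>x y. dist (1 - x * e) (1 - y * e) \<le> norm e * dist x y"
    proof (intro allI)
      fix x y
      have "1 - x * e - (1 - y * e) = (y - x) * e" by (simp add: algebra_simps)
      then show "dist (1 - x * e) (1 - y * e) \<le> norm e * dist x y"
        using norm_mult_ineq[of "y - x" e]
        by (simp only: dist_norm norm_minus_commute[of x] mult.commute[of "norm e"])
    qed
  qed (use assms in auto)
  then obtain y where y: "1 - y * e = y" by blast
  have *: "(1 + e) * x = 1" "y * (1 + e) = 1"
    using x y by (simp_all add: algebra_simps)
  then have "y = x" by (metis mult.assoc mult.left_neutral mult.right_neutral)
  with * show ?thesis unfolding invertible_elt_def by blast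
qed

text \<open>With \<open>s\<close> the inverse of \<open>r\<close>, the sum \<open>r + e\<close>
  factors as \<open>r * (1 + s * e)\<close>, which reduces the claim to a perturbation of 1.\<close>

lemma invertible_elt_perturb:
  fixes r :: "'a::{real_normed_algebra_1, banach}"
  assumes "invertible_elt r"
  obtains d where "d > 0" "\<And>e. norm e < d \<Longrightarrow> invertible_elt (r + e)"
proof -
  obtain s where s: "r * s = 1" "s * r = 1" using assms unfolding invertible_elt_def by blast
  show thesis
  proof (rule that)
    show "0 < 1 / (norm s + 1)" by (simp add: add_nonneg_pos)
    fix e :: 'a assume e: "norm e < 1 / (norm s + 1)"
    have "norm (s * e) \<le> norm s * norm e" by (rule norm_mult_ineq)
    also have "\<dots> \<le> (norm s + 1) * norm e" by (intro mult_right_mono) auto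
    also have "\<dots> < 1" using e by (simp add: pos_less_divide_eq add_nonneg_pos mult.commute)
    finally have "invertible_elt (r * (1 + s * e))"
      by (intro invertible_elt_mult assms invertible_elt_one_plus)
    moreover have "r * (1 + s * e) = r + e"
      by (simp add: distrib_left mult.assoc[symmetric] s)
    ultimately show "invertible_elt (r + e)" by simp
  qed
qed

text \<open>\<open>span\<close> is the real span; this doubles the dimension of a complex subspace
  but does not affect its finiteness.\<close>

definition finite_rank :: "'a ell2_op \<Rightarrow> bool"
  where "finite_rank T \<longleftrightarrow> (\<exists>B. finite B \<and> range (op_apply T) \<subseteq> span B)"

lemma finite_rank_0: "finite_rank 0"
  unfolding finite_rank_def by (rule exI[of _ "{}"]) (simp add: image_constant_conv)

lemma finite_rank_add:
  assumes "finite_rank S" "finite_rank T"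
  shows "finite_rank (S + T)"
proof -
  obtain B C where "finite B" "range (op_apply S) \<subseteq> span B" "finite C" "range (op_apply T) \<subseteq> span C"
    using assms unfolding finite_rank_def by blast
  then have "finite (B \<union> C)" "range (op_apply (S + T)) \<subseteq> span (B \<union> C)"
    using span_mono[of B "B \<union> C"] span_mono[of C "B \<union> C"] by (auto intro!: span_add)
  then show ?thesis unfolding finite_rank_def by blast
qed

lemma finite_rank_mult_left:
  assumes "finite_rank T"
  shows "finite_rank (S * T)"
proof -
  obtain B where B: "finite B" "range (op_apply T) \<subseteq> span B"
    using assms unfolding finite_rank_def by blast
  have "linear (op_apply S)" by (rule bounded_linear.linear[OF bounded_linear_op_apply])
  then have "range (op_apply (S * T)) \<subseteq> span (op_apply S ` B)"
    using B(2) by (auto simp: linear_span_image)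
  then show ?thesis unfolding finite_rank_def using B(1) by blast
qed

lemma finite_rank_scaleC:
  assumes "finite_rank T"
  shows "finite_rank (c *\<^sub>C T)"
  using finite_rank_mult_left[OF assms, of "c *\<^sub>C 1"] by (simp add: mult_scaleC_left)

lemma finite_rank_supported:
  assumes "finite E" "\<And>f x. x \<notin> E \<Longrightarrow> ell2_coord (op_apply T f) x = 0"
  shows "finite_rank T"
proof -
  \<comment> \<open>Over the reals each coordinate in \<open>E\<close> needs two spanning
    vectors.\<close>
  let ?B = "ket ` E \<union> (\<lambda>x. \<i> *\<^sub>C ket x) ` E"
  have "op_apply T f \<in> span ?B" for f
  proof -
    let ?c = "ell2_coord (op_apply T f)"
    have "op_apply T f = (\<Sum>x\<in>E. Re (?c x) *\<^sub>R ket x + Im (?c x) *\<^sub>R (\<i> *\<^sub>C ket x))"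
    proof (rule ell2_eqI)
      fix y
      have "?c y = (\<Sum>x\<in>E. if y = x then ?c x else 0)" using assms by simp
      also have "\<dots> = (\<Sum>x\<in>E. ell2_coord (Re (?c x) *\<^sub>R ket x + Im (?c x) *\<^sub>R (\<i> *\<^sub>C ket x)) y)"
        by (rule sum.cong) (auto simp: complex_eq_iff)
      finally show "?c y = ell2_coord (\<Sum>x\<in>E. Re (?c x) *\<^sub>R ket x + Im (?c x) *\<^sub>R (\<i> *\<^sub>C ket x)) y"
        by simp
    qed
    also have "\<dots> \<in> span ?B"
      by (intro span_sum span_add span_scale span_base) auto
    finally show ?thesis .
  qed
  then show ?thesis unfolding finite_rank_def using assms(1) by (intro exI[of _ ?B]) auto
qed

text \<open>These are exactly the Fredholm operators of index zero.\<close>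

definition index_zero :: "'a ell2_op \<Rightarrow> bool"
  where "index_zero T \<longleftrightarrow> (\<exists>R K. invertible_elt R \<and> finite_rank K \<and> T = R + K)"

lemma index_zeroI: "invertible_elt R \<Longrightarrow> finite_rank K \<Longrightarrow> index_zero (R + K)"
  unfolding index_zero_def by auto

text \<open>Dimension count: \<open>N\<close> carries a basis of \<open>span B\<close> to an
  independent set of the same size inside \<open>span B\<close>, so a vector missed by
  \<open>N\<close> could be added to it, giving too many independent vectors.\<close>

lemma linear_inj_on_span_surj:
  fixes N :: "'a::real_vector \<Rightarrow> 'a"
  assumes N: "linear N" "inj N" and B: "finite B" and sub: "N ` span B \<subseteq> span B"
  shows "span B \<subseteq> range N"
proof -
  obtain C where C: "C \<subseteq> span B" "independent C" "span B \<subseteq> span C"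
    using maximal_independent_subset by blast
  have sp: "span C = span B" by (intro antisym span_minimal C subspace_span)
  have fC: "finite C" using independent_span_bound[OF B C(2) C(1)] by blast
  have ind: "independent (N ` C)"
    by (rule linear_independent_injective_image[OF N(1) C(2)]) (rule inj_on_subset[OF N(2)], simp)
  have NC: "N ` C \<subseteq> span C" using C(1) sub sp by blast
  have "y \<in> range N" if "y \<in> span B" for y
  proof (rule ccontr)
    assume "y \<notin> range N"
    then have y: "y \<notin> span (N ` C)" using linear_span_image[OF N(1)] by blast
    have "independent (insert y (N ` C))" by (rule independent_insertI[OF y ind])
    moreover have "insert y (N ` C) \<subseteq> span C" using NC that sp by simp
    ultimately have "card (insert y (N ` C)) \<le> card C"
      using independent_span_bound[OF fC] by blast
    moreover have "y \<notin> N ` C" using y span_base[of y "N ` C"] by blast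
    moreover have "card (N ` C) = card C" by (rule card_image) (rule inj_on_subset[OF N(2)], simp)
    ultimately show False using fC by simp
  qed
  then show ?thesis by (rule subsetI)
qed

text \<open>The Fredholm alternative. Dividing by the invertible part leaves N = 1 + S K, which
  preserves the finite-dimensional space \<open>span B\<close> containing the range of S K; the
  dimension count applies there.\<close>

lemma index_zero_inj_imp_surj:
  assumes "index_zero T" and inj: "\<And>f. op_apply T f = 0 \<Longrightarrow> f = 0"
  shows "surj (op_apply T)"
proof -
  obtain R K where RK: "invertible_elt R" "finite_rank K" "T = R + K"
    using assms(1) unfolding index_zero_def by blast
  obtain S where S: "R * S = 1" "S * R = 1" using RK(1) unfolding invertible_elt_def by blast
  define N where "N = S * T"
  have N: "N = 1 + S * K" by (simp add: N_def RK(3) distrib_left S)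
  have T: "T = R * N" by (simp add: N_def mult.assoc[symmetric] S)
  obtain B where B: "finite B" "range (op_apply (S * K)) \<subseteq> span B"
    using finite_rank_mult_left[OF RK(2)] unfolding finite_rank_def by blast
  have lin: "linear (op_apply N)" by (rule bounded_linear.linear[OF bounded_linear_op_apply])
  have R0: "op_apply R 0 = 0"
    by (rule linear_0[OF bounded_linear.linear[OF bounded_linear_op_apply]])
  have "inj (op_apply N)"
    unfolding linear_injective_0[OF lin] using inj by (simp add: T R0)
  moreover have Nx: "op_apply N x = x + op_apply (S * K) x" for x by (simp add: N)
  then have "op_apply N ` span B \<subseteq> span B" using B(2) by (auto intro!: span_add)
  ultimately have sub: "span B \<subseteq> range (op_apply N)"
    by (intro linear_inj_on_span_surj lin B)
  have surjN: "\<exists>x. op_apply N x = y" for y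
  proof -
    have "op_apply (S * K) y \<in> range (op_apply N)" by (rule subsetD[OF sub subsetD[OF B(2) rangeI]])
    then obtain z where "op_apply N z = op_apply (S * K) y" by (elim rangeE) simp
    \<comment> \<open>N (y - z) equals y + S K y - N z, and the last two terms cancel by the choice
      of \<open>z\<close>.\<close>
    then have "op_apply N (y - z) = y" using linear_diff[OF lin, of y z] Nx[of y] by simp
    then show ?thesis ..
  qed
  have "\<exists>x. y = op_apply T x" for y
  proof -
    obtain x where "op_apply N x = op_apply S y" using surjN by blast
    then have "op_apply T x = op_apply (R * S) y" by (simp add: T)
    then show ?thesis using S(1) by (metis op_apply_ops(2))
  qed
  then show ?thesis unfolding surj_def by (rule allI)
qed

section \<open>Toeplitz compressions\<close>

definition ell2_restrict :: "'a set \<Rightarrow> 'a ell2 \<Rightarrow> 'a ell2"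
  where "ell2_restrict S f = Abs_ell2 (\<lambda>x. if x \<in> S then ell2_coord f x else 0)"

lemma sum_restrict_le:
  "finite F \<Longrightarrow> (\<Sum>x\<in>F. (cmod (if x \<in> S then ell2_coord f x else 0))\<^sup>2) \<le> (norm f)\<^sup>2"
  by (rule order_trans[OF sum_mono ell2_sum_le_norm]) auto

lemma ell2_restrict_coord:
  "ell2_coord (ell2_restrict S f) x = (if x \<in> S then ell2_coord f x else 0)"
  unfolding ell2_restrict_def
  by (subst Abs_ell2_inverse) (auto intro!: square_summable_bound sum_restrict_le)

lemma norm_ell2_restrict: "norm (ell2_restrict S f) \<le> norm f"
  by (rule ell2_norm_bound) (simp_all add: ell2_restrict_coord sum_restrict_le)

definition proj :: "'a set \<Rightarrow> 'a ell2_op"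
  where "proj S = mk_op (ell2_restrict S)"

lemma op_apply_proj: "op_apply (proj S) f = ell2_restrict S f"
  unfolding proj_def
  by (intro op_apply_mk_op bounded_linear_intro[where K = 1])
     (auto intro!: ell2_eqI simp: ell2_restrict_coord norm_ell2_restrict)

lemma proj_coord:
  "ell2_coord (op_apply (proj S) f) x = (if x \<in> S then ell2_coord f x else 0)"
  by (simp add: op_apply_proj ell2_restrict_coord)

lemma proj_idem: "proj S * proj S = proj S"
  by (rule op_eqI, rule ell2_eqI) (simp add: proj_coord)

lemma norm_proj: "norm (proj S) \<le> 1"
  by (rule norm_op_bound) (simp_all add: op_apply_proj norm_ell2_restrict)

text \<open>The compression to the subspace of vectors supported on \<open>S\<close> is extended by
  the identity on the complement, so that invertibility can be tested on the whole space.\<close>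

definition toeplitz :: "'a set \<Rightarrow> 'a ell2_op \<Rightarrow> 'a ell2_op"
  where "toeplitz S a = proj S * a * proj S + (1 - proj S)"

lemma toeplitz_coord:
  "ell2_coord (op_apply (toeplitz S a) f) x =
    (if x \<in> S then ell2_coord (op_apply a (op_apply (proj S) f)) x else ell2_coord f x)"
  by (simp add: toeplitz_def proj_coord)

text \<open>Compression fails to be multiplicative by the part of \<open>a\<close> that leaves the
  range of \<open>proj S\<close> before \<open>v\<close> brings it back; this error is compact as
  soon as \<open>(1 - proj S) * a * proj S\<close> is.\<close>

lemma toeplitz_mult:
  "toeplitz S (v * a) = toeplitz S v * toeplitz S a + proj S * v * ((1 - proj S) * a * proj S)"
proof -
  have "proj S * (proj S * x) = proj S * x" for x
    by (simp add: mult.assoc[symmetric] proj_idem)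
  then show ?thesis by (simp add: toeplitz_def algebra_simps proj_idem)
qed

lemma invertible_toeplitz_near_one:
  assumes "norm (v - 1) < 1"
  shows "invertible_elt (toeplitz S v)"
proof -
  have "norm (proj S * (v - 1) * proj S) \<le> norm (proj S) * norm (v - 1) * norm (proj S)"
    by (intro order_trans[OF norm_mult_ineq] mult_right_mono norm_mult_ineq) auto
  also have "\<dots> \<le> 1 * norm (v - 1) * 1"
    by (intro mult_mono norm_proj) auto
  finally have "norm (proj S * (v - 1) * proj S) < 1" using assms by simp
  moreover have "toeplitz S v = 1 + proj S * (v - 1) * proj S"
    by (simp add: toeplitz_def algebra_simps proj_idem)
  ultimately show ?thesis using invertible_elt_one_plus by metis
qed

text \<open>Write the compression of \<open>a\<close> as R + K and approximate the compact error by
  a finite-rank L. The remainder of the error is a small perturbation of the invertible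
  \<open>toeplitz S v * R\<close>, and all other terms have finite rank.\<close>

lemma index_zero_toeplitz_mult:
  assumes "index_zero (toeplitz S a)" "(1 - proj S) * a * proj S \<in> closure {T. finite_rank T}"
    and v: "norm (v - 1) < 1"
  shows "index_zero (toeplitz S (v * a))"
proof -
  obtain R K where RK: "invertible_elt R" "finite_rank K" "toeplitz S a = R + K"
    using assms(1) unfolding index_zero_def by blast
  let ?D = "(1 - proj S) * a * proj S" and ?A = "proj S * v"
  have "invertible_elt (toeplitz S v * R)"
    by (intro invertible_elt_mult invertible_toeplitz_near_one v RK)
  then obtain d where d: "d > 0" "\<And>e. norm e < d \<Longrightarrow> invertible_elt (toeplitz S v * R + e)"
    using invertible_elt_perturb by blast
  have "d / (norm ?A + 1) > 0" using d(1) by (simp add: add_nonneg_pos)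
  then obtain L where L: "finite_rank L" "dist L ?D < d / (norm ?A + 1)"
    using assms(2) unfolding closure_approachable by blast
  have "norm (?A * (?D - L)) \<le> norm ?A * norm (?D - L)" by (rule norm_mult_ineq)
  also have "\<dots> \<le> (norm ?A + 1) * norm (?D - L)" by (intro mult_right_mono) auto
  also have "\<dots> < d"
    using L(2) by (simp add: dist_norm norm_minus_commute pos_less_divide_eq add_nonneg_pos mult.commute)
  finally have "index_zero ((toeplitz S v * R + ?A * (?D - L)) + (toeplitz S v * K + ?A * L))"
    by (intro index_zeroI d finite_rank_add finite_rank_mult_left RK L)
  also have "(toeplitz S v * R + ?A * (?D - L)) + (toeplitz S v * K + ?A * L) = toeplitz S (v * a)"
    unfolding toeplitz_mult[of S v a] RK(3) by (simp add: algebra_simps)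
  finally show ?thesis .
qed

section \<open>Index zero along norm continuous paths of unitaries\<close>

lemma norm_star_le_1:
  fixes a :: "'a ell2_op"
  assumes "a * star a = 1"
  shows "norm (star a) \<le> 1"
proof (rule norm_op_bound)
  fix f
  have "op_apply a (op_apply (star a) f) = f"
    using assms by (metis op_apply_ops(2) op_apply_ops(6))
  then have "(norm (op_apply (star a) f))\<^sup>2 = (norm f)\<^sup>2"
    unfolding power2_norm_eq_inner inner_ell2_def star_ell2_op_def cinner_adjoint by simp
  then show "norm (op_apply (star a) f) \<le> 1 * norm f" by simp
qed simp

text \<open>For nearby parameters, \<open>a v\<close> is \<open>a u\<close> multiplied on the left
  by the unitary \<open>a v * star (a u)\<close>, which is close to 1. Hence index zero is a locally
  constant property, and connectedness finishes.\<close>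

lemma index_zero_toeplitz_path:
  fixes a :: "'t::topological_space \<Rightarrow> 'a ell2_op"
  assumes "connected I" "s \<in> I" "t \<in> I" and cont: "continuous_on I a"
    and unitary: "\<And>t. t \<in> I \<Longrightarrow> star (a t) * a t = 1" "\<And>t. t \<in> I \<Longrightarrow> a t * star (a t) = 1"
    and compact: "\<And>t. t \<in> I \<Longrightarrow> (1 - proj S) * a t * proj S \<in> closure {T. finite_rank T}"
  shows "index_zero (toeplitz S (a s)) = index_zero (toeplitz S (a t))"
proof (rule connected_local_const[OF assms(1-3)], intro ballI)
  have step: "index_zero (toeplitz S (a v))"
    if "u \<in> I" "v \<in> I" "dist (a u) (a v) < 1" "index_zero (toeplitz S (a u))" for u v
  proof -
    have "norm (a v * star (a u) - 1) = norm ((a v - a u) * star (a u))"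
      by (simp add: left_diff_distrib unitary that)
    also have "\<dots> \<le> norm (a v - a u) * 1"
      by (intro order_trans[OF norm_mult_ineq] mult_left_mono norm_star_le_1 unitary that) auto
    also have "\<dots> < 1" using that(3) by (simp add: dist_norm norm_minus_commute)
    finally have "index_zero (toeplitz S (a v * star (a u) * a u))"
      by (intro index_zero_toeplitz_mult compact that)
    then show ?thesis by (simp add: mult.assoc unitary that)
  qed
  fix u assume u: "u \<in> I"
  have "\<forall>\<^sub>F v in at u within I. dist (a v) (a u) < 1"
    using cont u unfolding continuous_on_def by (intro tendstoD) auto
  moreover have "\<forall>\<^sub>F v in at u within I. v \<in> I" by (simp add: eventually_at_filter)
  ultimately show "\<forall>\<^sub>F v in at u within I. index_zero (toeplitz S (a u)) = index_zero (toeplitz S (a v))"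
  proof eventually_elim
    case (elim v)
    \<comment> \<open>The step is used in both directions, giving equality of truth values.\<close>
    then show ?case using step[of u v] step[of v u] u by (auto simp: dist_commute)
  qed
qed

section \<open>An almost invariant set and its index\<close>

lemma left_regular_apply_coord:
  "ell2_coord (op_apply (left_regular g) f) x = ell2_coord f (- g + x)"
proof -
  have "inj (\<lambda>x. - g + x)" by (rule bij_is_inj[OF bij_left_translation])
  then show ?thesis
    unfolding left_regular_def
    by (subst op_apply_mk_op)
       (auto simp: bounded_linear_ell2_reindex ell2_reindex_scaleC ell2_reindex_coord)
qed

lemma complex_span_finite_rank: "complex_span {T. finite_rank T} \<subseteq> {T. finite_rank T}"
proof
  fix T :: "'a ell2_op" assume "T \<in> complex_span {T. finite_rank T}"
  then show "T \<in> {T. finite_rank T}"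
    by (induction rule: complex_span_induct)
       (auto intro: finite_rank_0 finite_rank_add finite_rank_scaleC)
qed

text \<open>The closure of the finite-rank operators is the ideal of compact operators. For
  \<open>left_regular g\<close> the operator maps into the coordinates g + h with h in
  \<open>S\<close> and g + h outside, which are finitely many; linearity and continuity do the
  rest.\<close>

lemma almost_invariant_compact:
  fixes S :: "'g::group_add set"
  assumes S: "\<And>g. finite {h \<in> S. g + h \<notin> S}" and a: "a \<in> reduced_group_algebra"
  shows "(1 - proj S) * a * proj S \<in> closure {T. finite_rank T}"
proof -
  have "(1 - proj S) * a * proj S \<in> closure (complex_span {T. finite_rank T})"
  proof (rule closure_complex_span_image[where \<phi> = "\<lambda>a. (1 - proj S) * a * proj S"])
    show "bounded_linear (\<lambda>a. (1 - proj S) * a * proj S)"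
      by (intro bounded_linear_compose[OF bounded_linear_mult_left] bounded_linear_mult_right)
    show "(1 - proj S) * (c *\<^sub>C T) * proj S = c *\<^sub>C ((1 - proj S) * T * proj S)" for c T
      by (simp only: mult_scaleC_left mult_scaleC_right)
    show "a \<in> closure (complex_span (range left_regular))"
      using a unfolding reduced_group_algebra_def .
    fix x :: "'g ell2_op" assume "x \<in> range left_regular"
    then obtain g where x: "x = left_regular g" by blast
    have "finite_rank ((1 - proj S) * x * proj S)"
    proof (rule finite_rank_supported)
      show "finite ((\<lambda>h. g + h) ` {h \<in> S. g + h \<notin> S})" by (intro finite_imageI S)
      fix f y assume y: "y \<notin> (\<lambda>h. g + h) ` {h \<in> S. g + h \<notin> S}"
      have "y = g + (- g + y)" by (simp add: add.assoc[symmetric])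
      then have "y \<in> S \<or> - g + y \<notin> S" using y by (metis (mono_tags, lifting) imageI mem_Collect_eq)
      then show "ell2_coord (op_apply ((1 - proj S) * x * proj S) f) y = 0"
        by (auto simp: x proj_coord left_regular_apply_coord)
    qed
    then show "(1 - proj S) * x * proj S \<in> closure (complex_span {T. finite_rank T})"
      by (intro closure_complex_span_base) simp
  qed
  then show ?thesis using closure_mono[OF complex_span_finite_rank] by blast
qed

text \<open>The compressed shift is injective, but its range misses \<open>ket g\<close>: coordinate
  \<open>g\<close> of any image would have to come from coordinate 0, which lies outside
  \<open>S\<close>. This contradicts the Fredholm alternative.\<close>

lemma not_index_zero_toeplitz_shift:
  fixes S :: "'g::group_add set"
  assumes shift: "\<And>h. h \<in> S \<Longrightarrow> g + h \<in> S" and g: "g \<in> S" "0 \<notin> S" and d: "d \<noteq> 0"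
  shows "\<not> index_zero (toeplitz S (d *\<^sub>C left_regular g))"
proof
  let ?T = "toeplitz S (d *\<^sub>C left_regular g)"
  assume "index_zero ?T"
  moreover have "f = 0" if "op_apply ?T f = 0" for f
  proof (rule ell2_eqI)
    fix h
    have *: "ell2_coord (op_apply ?T f) x = 0" for x by (simp add: that)
    show "ell2_coord f h = ell2_coord 0 h"
    proof (cases "h \<in> S")
      case True
      then show ?thesis
        using *[of "g + h"] shift d
        by (simp add: toeplitz_coord proj_coord left_regular_apply_coord add.assoc[symmetric])
    qed (use *[of h] in \<open>simp add: toeplitz_coord\<close>)
  qed
  ultimately have "surj (op_apply ?T)" by (rule index_zero_inj_imp_surj)
  then obtain f where "op_apply ?T f = ket g" by (metis surjD)
  moreover have "ell2_coord (op_apply ?T f) g = 0"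
    using g by (simp add: toeplitz_coord proj_coord left_regular_apply_coord)
  ultimately show False by simp
qed

lemma index_zero_toeplitz_scalar:
  assumes "c \<noteq> 0"
  shows "index_zero (toeplitz S (c *\<^sub>C 1))"
proof -
  have "toeplitz S (c *\<^sub>C 1) * toeplitz S (inverse c *\<^sub>C 1) = 1"
    "toeplitz S (inverse c *\<^sub>C 1) * toeplitz S (c *\<^sub>C 1) = 1"
    by (rule op_eqI, rule ell2_eqI, simp add: toeplitz_coord proj_coord assms)+
  then have "invertible_elt (toeplitz S (c *\<^sub>C 1))" unfolding invertible_elt_def by blast
  from index_zeroI[OF this finite_rank_0] show ?thesis by simp
qed

section \<open>Reduced words with a prescribed last letter\<close>

definition generator :: "'a \<Rightarrow> 'a free_group"
  where "generator x = Abs_free_group [(x, True)]"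

definition ends_with :: "'a \<times> bool \<Rightarrow> 'a free_group set"
  where "ends_with s = {h. word_of h \<noteq> [] \<and> last (word_of h) = s}"

lemma word_of_generator: "word_of (generator x) = [(x, True)]"
  by (simp add: generator_def Abs_free_group_inverse reduced_word_def)

text \<open>Each letter of \<open>u\<close> cancels at most one letter at the front of
  \<open>w\<close>, so a longer \<open>w\<close> keeps its last letter. The length bound is carried
  along to make the induction work.\<close>

lemma last_reduced_append:
  "length u < length w \<Longrightarrow>
    length w \<le> length (reduced_append u w) + length u \<and> last (reduced_append u w) = last w"
proof (induction u)
  case (Cons s u)
  let ?v = "reduced_append u w"
  have IH: "length w \<le> length ?v + length u" "last ?v = last w" using Cons by auto
  \<comment> \<open>At least two letters remain, so cancelling the first one does not touch the
    last.\<close>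
  then obtain t t' v where "?v = t # t' # v"
    using Cons.prems by (cases ?v rule: remdups_adj.cases) auto
  then show ?case using IH by auto
qed simp

text \<open>Only words no longer than \<open>g\<close> can lose their last letter, and over a finite
  alphabet there are finitely many of them.\<close>

lemma ends_with_almost_invariant:
  fixes g :: "'a::finite free_group"
  shows "finite {h \<in> ends_with s. g + h \<notin> ends_with s}"
proof (rule finite_subset)
  let ?L = "{w :: ('a \<times> bool) list. length w \<le> length (word_of g)}"
  show "finite (Abs_free_group ` ?L)"
    using finite_lists_length_le[of "UNIV :: ('a \<times> bool) set"] by simp
  show "{h \<in> ends_with s. g + h \<notin> ends_with s} \<subseteq> Abs_free_group ` ?L"
  proof
    fix h assume h: "h \<in> {h \<in> ends_with s. g + h \<notin> ends_with s}"
    have "\<not> length (word_of g) < length (word_of h)"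
      using h last_reduced_append[of "word_of g" "word_of h"]
      by (auto simp: ends_with_def word_of_ops)
    then show "h \<in> Abs_free_group ` ?L"
      by (intro image_eqI[of _ _ "word_of h"]) (simp_all add: word_of_inverse)
  qed
qed

text \<open>Cancellation happens only if the word starts with the inverse letter; that letter is not
  its last one, so the ending survives.\<close>

lemma generator_shift_ends_with:
  assumes "h \<in> ends_with (x, True)"
  shows "generator x + h \<in> ends_with (x, True)"
  using assms
  by (cases "word_of h")
     (auto simp: ends_with_def word_of_ops word_of_generator flip_letter_def split: if_splits)

lemma ends_with_generator: "generator x \<in> ends_with (x, True)" "0 \<notin> ends_with s"
  by (simp_all add: ends_with_def word_of_generator word_of_ops)

section \<open>Slices of operators on a tensor product\<close>

lemma norm_ell2_tensor_ket: "norm (ell2_tensor f (ket y)) \<le> norm f"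
proof (rule ell2_norm_bound)
  fix F :: "('a \<times> 'b) set" assume F: "finite F"
  let ?F = "{z \<in> F. snd z = y}"
  have "(\<Sum>z\<in>F. (cmod (ell2_coord (ell2_tensor f (ket y)) z))\<^sup>2) = (\<Sum>z\<in>?F. (cmod (ell2_coord f (fst z)))\<^sup>2)"
    using F by (intro sum.mono_neutral_cong_right) (auto simp: ell2_tensor_coord split: if_splits)
  also have "\<dots> = (\<Sum>x\<in>fst ` ?F. (cmod (ell2_coord f x))\<^sup>2)"
    by (subst sum.reindex) (auto simp: inj_on_def)
  also have "\<dots> \<le> (norm f)\<^sup>2" using F by (intro ell2_sum_le_norm) simp
  finally show "(\<Sum>z\<in>F. (cmod (ell2_coord (ell2_tensor f (ket y)) z))\<^sup>2) \<le> (norm f)\<^sup>2" .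
qed simp

text \<open>\<open>op_slice y z\<close> is \<open>id \<otimes> \<omega>\<close> for the functional \<open>\<omega>(h) = \<langle>\<delta>\<^sub>z, h\<delta>\<^sub>y\<rangle>\<close>.\<close>

definition op_slice :: "'b \<Rightarrow> 'b \<Rightarrow> ('a \<times> 'b) ell2_op \<Rightarrow> 'a ell2_op"
  where "op_slice y z T = mk_op (\<lambda>f. ell2_slice (op_apply T (ell2_tensor f (ket y))) z)"

lemma op_slice_apply:
  "op_apply (op_slice y z T) f = ell2_slice (op_apply T (ell2_tensor f (ket y))) z"
proof -
  interpret T: bounded_linear "op_apply T" by (rule bounded_linear_op_apply)
  have add: "ell2_tensor (f + g) (ket y) = ell2_tensor f (ket y) + ell2_tensor g (ket y)"
    and scaleR: "ell2_tensor (r *\<^sub>R f) (ket y) = r *\<^sub>R ell2_tensor f (ket y)"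
    and scaleC: "ell2_tensor (c *\<^sub>C f) (ket y) = c *\<^sub>C ell2_tensor f (ket y)" for f g :: "'a ell2" and r c
    by (rule ell2_eqI, simp add: split_paired_all ell2_tensor_coord algebra_simps)+
  show ?thesis
    unfolding op_slice_def
  proof (intro op_apply_mk_op bounded_linear_intro[where K = "norm T"])
    fix f
    have "norm (ell2_slice (op_apply T (ell2_tensor f (ket y))) z) \<le> norm (op_apply T (ell2_tensor f (ket y)))"
      unfolding ell2_slice_def by (rule norm_ell2_reindex) (simp add: inj_def)
    also have "\<dots> \<le> norm T * norm (ell2_tensor f (ket y))" by (rule norm_op_apply)
    also have "\<dots> \<le> norm T * norm f" by (intro mult_left_mono norm_ell2_tensor_ket) simp
    finally show "norm (ell2_slice (op_apply T (ell2_tensor f (ket y))) z) \<le> norm f * norm T"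
      by (simp add: mult.commute)
  qed (simp_all add: add scaleR scaleC T.add T.scaleR op_apply_scaleC ell2_slice_add ell2_slice_scaleR ell2_slice_scaleC)
qed

lemma op_slice_ket_coord:
  "ell2_coord (op_apply (op_slice y z T) (ket a)) b = ell2_coord (op_apply T (ket (a, y))) (b, z)"
  by (simp add: op_slice_apply ket_tensor)

lemma bounded_linear_op_slice: "bounded_linear (op_slice y z)"
proof (rule bounded_linear_intro[where K = 1])
  fix T :: "('a \<times> 'b) ell2_op"
  show "norm (op_slice y z T) \<le> norm T * 1"
  proof (rule norm_op_bound)
    fix f
    have "norm (op_apply (op_slice y z T) f) \<le> norm (op_apply T (ell2_tensor f (ket y)))"
      unfolding op_slice_apply ell2_slice_def by (rule norm_ell2_reindex) (simp add: inj_def)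
    also have "\<dots> \<le> norm T * norm (ell2_tensor f (ket y))" by (rule norm_op_apply)
    also have "\<dots> \<le> norm T * norm f" by (intro mult_left_mono norm_ell2_tensor_ket) simp
    finally show "norm (op_apply (op_slice y z T) f) \<le> norm T * 1 * norm f" by simp
  qed simp
qed (auto intro!: op_eqI simp: op_slice_apply ell2_slice_add ell2_slice_scaleR)

lemma op_slice_scaleC: "op_slice y z (c *\<^sub>C T) = c *\<^sub>C op_slice y z T"
  by (rule op_eqI) (simp add: op_slice_apply ell2_slice_scaleC)

lemma op_slice_one: "op_slice y y 1 = 1"
  by (rule op_ext_ket, rule ell2_eqI) (simp add: op_slice_ket_coord)

lemma op_slice_star: "op_slice y z (star T) = star (op_slice z y T)"
  by (rule star_op_eqI) (simp add: op_slice_ket_coord star_op_coord)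

lemma op_slice_tensor: "op_slice y z (a \<otimes>\<^sub>o h) = ell2_coord (op_apply h (ket y)) z *\<^sub>C a"
  by (rule op_ext_ket, rule ell2_eqI) (simp add: op_slice_ket_coord op_tensor_ket_coord)

text \<open>In general a slice of a product is a sum over intermediate indices; the hypothesis
  leaves only the index \<open>z\<close>.\<close>

lemma op_slice_mult:
  assumes "\<And>w. w \<noteq> z \<Longrightarrow> op_slice y w T = 0"
  shows "op_slice z w S * op_slice y z T = op_slice y w (S * T)"
proof (rule op_eqI)
  fix f
  have "op_apply T (ell2_tensor f (ket y)) = ell2_tensor (op_apply (op_slice y z T) f) (ket z)"
  proof (rule ell2_eqI)
    fix p :: "'b \<times> 'a"
    obtain x w where p: "p = (x, w)" by (cases p)
    have "ell2_coord (op_apply T (ell2_tensor f (ket y))) (x, w) = ell2_coord (op_apply (op_slice y w T) f) x"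
      by (simp add: op_slice_apply)
    also have "\<dots> = ell2_coord (ell2_tensor (op_apply (op_slice y z T) f) (ket z)) (x, w)"
      using assms[of w] by (simp add: ell2_tensor_coord)
    finally show "ell2_coord (op_apply T (ell2_tensor f (ket y))) p
        = ell2_coord (ell2_tensor (op_apply (op_slice y z T) f) (ket z)) p"
      by (simp add: p)
  qed
  then show "op_apply (op_slice z w S * op_slice y z T) f = op_apply (op_slice y w (S * T)) f"
    by (simp add: op_slice_apply)
qed

text \<open>Slicing sends an elementary tensor to a multiple of its first leg, and boundedness
  extends this to the closure.\<close>

lemma op_slice_in:
  assumes "T \<in> reduced_group_algebra \<otimes>\<^sub>m H"
  shows "op_slice y z T \<in> reduced_group_algebra"
  unfolding reduced_group_algebra_def
proof (rule closure_complex_span_image[OF bounded_linear_op_slice op_slice_scaleC])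
  show "T \<in> closure (complex_span {a \<otimes>\<^sub>o b | a b. a \<in> reduced_group_algebra \<and> b \<in> H})"
    using assms unfolding min_tensor_def .
  fix x :: "('a \<times> 'b) ell2_op"
  assume "x \<in> {a \<otimes>\<^sub>o b | a b. a \<in> reduced_group_algebra \<and> b \<in> H}"
  then obtain a b where x: "x = a \<otimes>\<^sub>o b" "a \<in> reduced_group_algebra" by blast
  show "op_slice y z x \<in> closure (complex_span (range left_regular))"
    unfolding x(1) op_slice_tensor
    by (rule closure_complex_span_scaleC) (use x(2) in \<open>simp add: reduced_group_algebra_def\<close>)
qed

text \<open>A solution of \<open>(id \<otimes> \<Delta>)(U) = U \<otimes> g\<close> lies in the spectral subspace \<open>A \<otimes> g\<close>; its first leg is
  \<open>op_slice 0 g U\<close>.\<close>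

lemma homogeneous_slice_eq_0:
  assumes U: "shear snd U = U \<otimes>\<^sub>o left_regular g" and "z \<noteq> g + y"
  shows "op_slice y z U = 0"
proof (rule op_ext_ket, rule ell2_eqI)
  fix a b
  \<comment> \<open>With the third index equal to the second at both ends, the condition in
    \<open>shear_ket_coord\<close> reads 0 = 0. The factor \<open>left_regular g\<close> vanishes at
    this coefficient.\<close>
  have "ell2_coord (op_apply U (ket (a, y))) (b, z)
      = ell2_coord (op_apply (shear snd U) (ket ((a, y), y))) ((b, z), z)"
    by (simp add: shear_ket_coord)
  also have "\<dots> = 0"
    using assms by (simp add: U op_tensor_ket_coord left_regular_coord)
  finally show "ell2_coord (op_apply (op_slice y z U) (ket a)) b = ell2_coord (op_apply 0 (ket a)) b"
    by (simp add: op_slice_ket_coord)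
qed

text \<open>\<open>U\<close> maps vectors with second leg \<open>ket 0\<close> to vectors with
  second leg \<open>ket g\<close>, and \<open>star U\<close> maps them back, so the slice is a
  unitary between these two copies of the first factor.\<close>

lemma homogeneous_slice_unitary:
  assumes U: "shear snd U = U \<otimes>\<^sub>o left_regular g" and "star U * U = 1" "U * star U = 1"
  shows "star (op_slice 0 g U) * op_slice 0 g U = 1"
    and "op_slice 0 g U * star (op_slice 0 g U) = 1"
proof -
  have "op_slice 0 w U = 0" if "w \<noteq> g" for w
    using homogeneous_slice_eq_0[OF U, of w 0] that by simp
  then show "star (op_slice 0 g U) * op_slice 0 g U = 1"
    by (simp add: op_slice_star[symmetric] op_slice_mult assms op_slice_one)
  have "op_slice g w (star U) = 0" if "w \<noteq> 0" for w
  proof -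
    have "star (0 :: 'a ell2_op) = 0" using star_add[of "0 :: 'a ell2_op" 0] by simp
    moreover have "g \<noteq> g + w" using that by (metis add.right_neutral add_left_cancel)
    ultimately show ?thesis by (simp add: op_slice_star homogeneous_slice_eq_0[OF U])
  qed
  then show "op_slice 0 g U * star (op_slice 0 g U) = 1"
    by (simp add: op_slice_star[symmetric] op_slice_mult assms op_slice_one)
qed

section \<open>Values of the coproduct\<close>

text \<open>Used to identify maps obtained by choice with explicit ones. Linearity is required on
  \<open>C\<close> alone, since a chosen homomorphism is controlled only on its algebra.\<close>

lemma agree_on_closure_span:
  fixes S :: "'a ell2_op set" and \<phi> \<psi> :: "'a ell2_op \<Rightarrow> 'b ell2_op"
  defines "C \<equiv> closure (complex_span S)"
  assumes cont: "continuous_on (C) \<phi>" "continuous_on (C) \<psi>"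
    and lin: "\<And>c x y. x \<in> C \<Longrightarrow> y \<in> C \<Longrightarrow> \<phi> (c *\<^sub>C x + y) = c *\<^sub>C \<phi> x + \<phi> y"
      "\<And>c x y. x \<in> C \<Longrightarrow> y \<in> C \<Longrightarrow> \<psi> (c *\<^sub>C x + y) = c *\<^sub>C \<psi> x + \<psi> y"
    and S: "\<And>x. x \<in> S \<Longrightarrow> \<phi> x = \<psi> x" and x: "x \<in> C"
  shows "\<phi> x = \<psi> x"
proof -
  have sub: "complex_span S \<subseteq> C" unfolding C_def by (rule closure_subset)
  have "0 \<in> C" unfolding C_def by (rule closure_complex_span_zero)
  then have zero: "\<phi> 0 = 0" "\<psi> 0 = 0"
    using lin(1)[of 0 0 1] lin(2)[of 0 0 1] by (simp_all add: scaleC_one)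
  have "\<phi> x - \<psi> x = 0" if "x \<in> complex_span S" for x
    using that
  proof (induction rule: complex_span_induct)
    case (step c x y)
    moreover have "x \<in> C" "y \<in> C" using step(1,2) complex_span_base sub by blast+
    ultimately show ?case by (simp add: lin S)
  qed (simp add: zero)
  then have "\<phi> x - \<psi> x = 0"
    using continuous_constant_on_closure[of "complex_span S" "\<lambda>x. \<phi> x - \<psi> x" 0 x] x cont
    unfolding C_def by (auto intro: continuous_on_diff)
  then show ?thesis by simp
qed

section \<open>The coproduct and its amplification as shears\<close>

lemma star_hom_linear:
  fixes S :: "'a ell2_op set" and \<phi> :: "'a ell2_op \<Rightarrow> 'b ell2_op"
  assumes "star_hom (closure (complex_span S)) B \<phi>"
    and "x \<in> closure (complex_span S)" "y \<in> closure (complex_span S)"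
  shows "\<phi> (c *\<^sub>C x + y) = c *\<^sub>C \<phi> x + \<phi> y"
  using assms closure_complex_span_scaleC[OF assms(2), of c] unfolding star_hom_def by simp

lemma bounded_linear_shear: "bounded_linear (shear p)"
  using star_embedding_shear unfolding star_embedding_def by blast

lemma shear_linear: "shear p (c *\<^sub>C x + y) = c *\<^sub>C shear p x + shear p y"
  by (simp add: linear_add[OF bounded_linear.linear[OF bounded_linear_shear]]
      star_embedding_scaleC[OF star_embedding_shear])

text \<open>Both maps send \<open>left_regular g\<close> to its tensor square. The shear has
  explicit matrix coefficients, which the chosen coproduct lacks.\<close>

lemma group_comult_eq_shear:
  fixes b :: "'g::group_add ell2_op"
  assumes "b \<in> reduced_group_algebra"
  shows "group_comult b = shear (\<lambda>x. x) b"
proof (rule agree_on_closure_span[where \<phi> = group_comult and \<psi> = "shear (\<lambda>x. x)" and S = "range left_regular"])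
  fix c and x y :: "'g ell2_op"
  assume "x \<in> closure (complex_span (range left_regular))" "y \<in> closure (complex_span (range left_regular))"
  then show "group_comult (c *\<^sub>C x + y) = c *\<^sub>C group_comult x + group_comult y"
    using star_hom_linear group_comult_star_hom unfolding reduced_group_algebra_def by blast
qed (use assms group_comult_continuous in \<open>auto simp: shear_linear shear_left_regular
    group_comult_left_regular reduced_group_algebra_def
    intro: linear_continuous_on bounded_linear_shear\<close>)

lemma id_tensor_comult_eq_shear:
  fixes A :: "'a ell2_op set" and U :: "('a \<times> 'g::group_add) ell2_op"
  assumes "U \<in> A \<otimes>\<^sub>m reduced_group_algebra"
  shows "id_tensor_comult A reduced_group_algebra group_comult U = shear snd U"
proof (rule agree_on_closure_span[where \<psi> = "shear snd"
      and \<phi> = "id_tensor_comult A reduced_group_algebra group_comult"])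
  let ?H = "reduced_group_algebra :: 'g ell2_op set"
  let ?S = "{a \<otimes>\<^sub>o b | a b. a \<in> A \<and> b \<in> ?H}"
  note def = min_tensor_def[of A ?H]
  show "U \<in> closure (complex_span ?S)" using assms unfolding def .
  show "continuous_on (closure (complex_span ?S)) (id_tensor_comult A ?H group_comult)"
    unfolding def[symmetric] by (rule id_tensor_comult(2))
  show "continuous_on (closure (complex_span ?S)) (shear snd)"
    by (rule linear_continuous_on[OF bounded_linear_shear])
  show "id_tensor_comult A ?H group_comult (c *\<^sub>C x + y)
      = c *\<^sub>C id_tensor_comult A ?H group_comult x + id_tensor_comult A ?H group_comult y"
    if "x \<in> closure (complex_span ?S)" "y \<in> closure (complex_span ?S)" for c x y
    by (rule star_hom_linear[OF _ that], unfold def[symmetric]) (rule id_tensor_comult(1))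
  show "id_tensor_comult A ?H group_comult x = shear snd x" if "x \<in> ?S" for x
    using that by (auto simp: id_tensor_comult(3) shear_tensor)
qed (rule shear_linear)

text \<open>The coproduct turns a sum of b_h h into the sum of b_h (h tensor h), and this slice
  keeps only the term h = g. It determines the endpoint of the path at 1.\<close>

lemma op_slice_group_comult:
  assumes "b \<in> reduced_group_algebra"
  shows "op_slice 0 g (group_comult b) = ell2_coord (op_apply b (ket 0)) g *\<^sub>C left_regular g"
proof -
  let ?\<psi> = "\<lambda>b. ell2_coord (op_apply b (ket 0)) g *\<^sub>C left_regular g"
  have "op_slice 0 g (shear (\<lambda>x. x) b) = ?\<psi> b"
  proof (rule agree_on_closure_span[where \<psi> = ?\<psi> and S = "range left_regular"
        and \<phi> = "\<lambda>b. op_slice 0 g (shear (\<lambda>x. x) b)"])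
    have "bounded_linear (\<lambda>b. op_slice 0 g (shear (\<lambda>x :: 'a. x) b))"
      by (rule bounded_linear_compose[OF bounded_linear_op_slice bounded_linear_shear])
    then show "continuous_on (closure (complex_span (range left_regular))) (\<lambda>b. op_slice 0 g (shear (\<lambda>x :: 'a. x) b))"
      by (rule linear_continuous_on)
    have "bounded_linear ?\<psi>"
    proof (rule bounded_linear_intro[where K = "norm (left_regular g)"])
      fix b
      have "norm (?\<psi> b) \<le> cmod (ell2_coord (op_apply b (ket 0)) g) * norm (left_regular g)"
      proof (rule norm_op_bound)
        fix f
        show "norm (op_apply (ell2_coord (op_apply b (ket 0)) g *\<^sub>C left_regular g) f)
            \<le> cmod (ell2_coord (op_apply b (ket 0)) g) * norm (left_regular g) * norm f"
          using mult_left_mono[OF norm_op_apply[of "left_regular g" f], of "cmod (ell2_coord (op_apply b (ket 0)) g)"]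
          by (simp add: mult.assoc)
      qed simp
      also have "\<dots> \<le> norm b * norm (left_regular g)"
        using order_trans[OF ell2_coord_le_norm norm_op_apply[of b "ket 0"]]
        by (intro mult_right_mono) auto
      finally show "norm (?\<psi> b) \<le> norm b * norm (left_regular g)" .
    qed (auto intro!: op_eqI simp: scaleC_add_left scaleC_ell2_laws ell2_scaleR_scaleC)
    then show "continuous_on (closure (complex_span (range left_regular))) ?\<psi>"
      by (rule linear_continuous_on)
    show "op_slice 0 g (shear (\<lambda>x :: 'a. x) (c *\<^sub>C x + y))
        = c *\<^sub>C op_slice 0 g (shear (\<lambda>x. x) x) + op_slice 0 g (shear (\<lambda>x. x) y)" for c x y
      by (simp add: shear_linear linear_add[OF bounded_linear.linear[OF bounded_linear_op_slice]] op_slice_scaleC)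
    show "?\<psi> (c *\<^sub>C x + y) = c *\<^sub>C ?\<psi> x + ?\<psi> y" for c x y
      by (simp add: scaleC_add_left scaleC_scaleC)
    show "b \<in> closure (complex_span (range left_regular))"
      using assms unfolding reduced_group_algebra_def .
  next
    fix x :: "'a ell2_op" assume "x \<in> range left_regular"
    then obtain h where x: "x = left_regular h" by blast
    \<comment> \<open>For \<open>h\<close> different from \<open>g\<close> both sides are zero, but
      as multiples of different operators.\<close>
    have "0 *\<^sub>C left_regular h = 0 *\<^sub>C left_regular g" by (simp add: scaleC_zero)
    then show "op_slice 0 g (shear (\<lambda>x. x) x) = ?\<psi> x"
      by (auto simp: x shear_left_regular op_slice_tensor left_regular_coord)
  qed
  then show ?thesis by (simp add: group_comult_eq_shear[OF assms])
qed

section \<open>The unitary path of an equivariant homomorphism\<close>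

lemma connected_unit_interval: "connected (UNIV :: unit_interval set)"
proof -
  have "continuous_on {0..1} Abs_ui"
    unfolding continuous_on_iff by (auto simp: dist_unit_interval_def Abs_ui_inverse)
  then have "connected (Abs_ui ` {0..1})" by (rule connected_continuous_image) simp
  moreover have "Abs_ui ` {0..1} = UNIV"
    using Abs_ui_cases by (metis UNIV_eq_I imageI)
  ultimately show ?thesis by simp
qed

lemma left_regular_unitary:
  "star (left_regular g) = left_regular (- g)"
  "star (left_regular g) * left_regular g = 1" "left_regular g * star (left_regular g) = 1"
proof -
  show s: "star (left_regular g) = left_regular (- g)"
    by (rule star_op_eqI[symmetric]) (auto simp: left_regular_coord add.assoc[symmetric])
  show "star (left_regular g) * left_regular g = 1" "left_regular g * star (left_regular g) = 1"
    unfolding s by (rule op_ext_ket, simp add: left_regular_ket add.assoc[symmetric])+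
qed

theorem theorem3p8:
  fixes n :: nat
  assumes "n > 1" and "CARD('gen::finite) = n"
  shows "\<not> (\<exists>F.
    star_hom (reduced_group_algebra :: 'gen free_group ell2_op set)
      (equivariant_join reduced_group_algebra reduced_group_algebra group_comult) F \<and>
    join_equivariant reduced_group_algebra reduced_group_algebra group_comult group_comult F)"
proof
  let ?A = "reduced_group_algebra :: 'gen free_group ell2_op set"
  assume "\<exists>F. star_hom ?A (equivariant_join ?A ?A group_comult) F \<and>
    join_equivariant ?A ?A group_comult group_comult F"
  then obtain F \<Phi> where F: "star_hom ?A (equivariant_join ?A ?A group_comult) F"
    and \<Phi>: "is_tensor_id ?A ?A F \<Phi>"
    and eq: "\<And>a. a \<in> ?A \<Longrightarrow> join_coaction ?A ?A group_comult (F a) = \<Phi> (group_comult a)"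
    unfolding join_equivariant_def by blast
  \<comment> \<open>Any generator will do.\<close>
  define x :: 'gen where "x = undefined"
  define g where "g = generator x"
  define U where "U = F (left_regular g)"
  define a where "a t = op_slice 0 g (U t)" for t
  define S where "S = ends_with (x, True)"
  have "U \<in> equivariant_join ?A ?A group_comult"
    using F left_regular_in unfolding U_def star_hom_def by blast
  then have cont: "continuous_on UNIV U" and U: "\<And>t. U t \<in> ?A \<otimes>\<^sub>m ?A"
    and U0: "\<exists>c h. U 0 = (c *\<^sub>C 1) \<otimes>\<^sub>o h" and U1: "\<exists>b\<in>?A. U 1 = group_comult b"
    unfolding equivariant_join_def path_algebra_def by auto
  \<comment> \<open>Equivariance is evaluated at the group-like element
    \<open>left_regular g\<close>, where \<open>group_comult\<close> gives an elementary tensor and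
    \<open>is_tensor_id\<close> applies.\<close>
  have homogeneous: "shear snd (U t) = U t \<otimes>\<^sub>o left_regular g" for t
  proof -
    have "shear snd (U t) = join_coaction ?A ?A group_comult U t"
      by (simp add: join_coaction_def id_tensor_comult_eq_shear[OF U])
    also have "\<dots> = \<Phi> (left_regular g \<otimes>\<^sub>o left_regular g) t"
      unfolding U_def by (simp add: eq left_regular_in group_comult_left_regular)
    also have "\<dots> = U t \<otimes>\<^sub>o left_regular g"
      using \<Phi> left_regular_in[of g] unfolding is_tensor_id_def U_def by simp
    finally show ?thesis .
  qed
  have star_in: "star (left_regular g) \<in> ?A"
    unfolding left_regular_unitary(1) by (rule left_regular_in)
  \<comment> \<open>\<open>F\<close> preserves unit, product and star, and the operations on paths
    are pointwise, so each \<open>U t\<close> inherits unitarity from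
    \<open>left_regular g\<close>.\<close>
  then have "star U * U = 1" "U * star U = 1"
    using F left_regular_in[of g] left_regular_unitary[of g] unfolding U_def star_hom_def by metis+
  then have "star (U t) * U t = 1" "U t * star (U t) = 1" for t
    by (auto simp: fun_eq_iff star_fun_def)
  then have unitary: "star (a t) * a t = 1" "a t * star (a t) = 1" for t
    unfolding a_def using homogeneous_slice_unitary[OF homogeneous] by blast+
  have "index_zero (toeplitz S (a 0)) = index_zero (toeplitz S (a 1))"
  proof (rule index_zero_toeplitz_path[OF connected_unit_interval])
    show "continuous_on UNIV a"
      unfolding a_def by (rule bounded_linear.continuous_on[OF bounded_linear_op_slice cont])
    show "(1 - proj S) * a t * proj S \<in> closure {T. finite_rank T}" for t
      unfolding S_def a_def
      by (intro almost_invariant_compact ends_with_almost_invariant op_slice_in[OF U])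
  qed (auto simp: unitary)
  moreover have "index_zero (toeplitz S (a 0))"
  proof -
    obtain c h where "U 0 = (c *\<^sub>C 1) \<otimes>\<^sub>o h" using U0 by blast
    then have a0: "a 0 = (ell2_coord (op_apply h (ket 0)) g * c) *\<^sub>C 1"
      by (simp add: a_def op_slice_tensor scaleC_scaleC)
    \<comment> \<open>Unitarity rules out the zero scalar, which the boundary condition at 0 alone
      would allow.\<close>
    moreover have "a 0 \<noteq> 0" using unitary(1)[of 0] by auto
    ultimately have "ell2_coord (op_apply h (ket 0)) g * c \<noteq> 0" by (metis scaleC_zero)
    then show ?thesis unfolding a0 by (rule index_zero_toeplitz_scalar)
  qed
  moreover have "\<not> index_zero (toeplitz S (a 1))"
  proof -
    obtain b where "b \<in> ?A" "U 1 = group_comult b" using U1 by blast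
    then have a1: "a 1 = ell2_coord (op_apply b (ket 0)) g *\<^sub>C left_regular g"
      by (simp add: a_def op_slice_group_comult)
    moreover have "a 1 \<noteq> 0" using unitary(1)[of 1] by auto
    ultimately have "ell2_coord (op_apply b (ket 0)) g \<noteq> 0" by (metis scaleC_zero)
    then show ?thesis
      unfolding a1 S_def g_def
      by (intro not_index_zero_toeplitz_shift generator_shift_ends_with ends_with_generator)
  qed
  ultimately show False by blast
qed

end
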